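(* Let $n\ge2$ be an integer and for $R>0$ let $u_R$ denote the solution of $$\frac{u''}{1+(u')^2}=\frac{n-1}{u}-\frac u2+\frac x2u',\qquad u(0)=R,\quad u'(0)=0 .$$ (i) Suppose $R_1>R_2>\sqrt{2n}$ and that there exist $b_{R_1}>0$ and $b_{R_2}>0$ such that $u_{R_1}'(b_{R_1})=u_{R_2}'(b_{R_2})=-\infty$. Then for every $R\in(R_2,R_1)$ there exists $b_R>0$ such that $u_R'(b_R)=-\infty$, and $u_R''(x)<0$ on the corresponding branch $0<x<b_R$. Moreover, the vertical point $(b_R,u_R(b_R))$ depends continuously on $R$, unless the vertical points reach the axis $r=0$ or escape to infinity. (ii) Suppose $0<R_2<R_1<\sqrt{2(n-1)}$ and that there exist $b_{R_1}>0$ and $b_{R_2}>0$ such that $u_{R_1}'(b_{R_1})=u_{R_2}'(b_{R_2})=+\infty$. Then for every $R\in(R_2,R_1)$ there exists $b_R>0$ such that $u_R'(b_R)=+\infty$, and $u_R''(x)>0$ on the corresponding branch $0<x<b_R$. Moreover, the vertical point $(b_R,u_R(b_R))$ depends continuously on $R$, unless the vertical points escape to infinity.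
   Context: The equation is that of profile curves $r=u(x)$ of rotationally symmetric self-shrinkers in $\mathbb R^{n+1}$ (rotation about the $x$-axis), in the $(x,r)$-plane with $u>0$. A vertical point of $u$ is a point of its graph at which $|u'|=\infty$; $u_R'(b_R)=\pm\infty$ with $b_R>0$ means that $u_R$ is defined on $[0,b_R)$, that $u_R'(x)\to\pm\infty$ as $x\to b_R^-$, and $u_R(b_R)$ denotes the limit $\lim_{x\to b_R^-}u_R(x)$. The "unless" clause excludes the values of $R$ at which the vertical points of nearby solutions accumulate on the axis $\{r=0\}$ or are unbounded in the $(x,r)$-plane. *)

theory Defs
  imports "HOL-Analysis.Analysis"
begin

definition profile_solution ::
    "nat \<Rightarrow> real \<Rightarrow> real \<Rightarrow> real \<Rightarrow> (real \<Rightarrow> real) \<Rightarrow> bool" where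
  "profile_solution n R a b u \<longleftrightarrow>
     a < 0 \<and> 0 < b \<and> u 0 = R \<and> deriv u 0 = 0 \<and>
     (\<forall>x\<in>{a<..<b}.
        u x > 0 \<and> u differentiable at x \<and> deriv u differentiable at x \<and>
        deriv (deriv u) x / (1 + (deriv u x)\<^sup>2) =
          (real n - 1) / u x - u x / 2 + x / 2 * deriv u x)"

(* The initial value problem has unique solutions, so the solutions on all open intervals
   around 0 glue to one maximal solution u_R; profile n R is u_R, and its values
   outside profile_dom n R carry no meaning. *)

definition profile_dom :: "nat \<Rightarrow> real \<Rightarrow> real set" where
  "profile_dom n R = {x. \<exists>a b u. profile_solution n R a b u \<and> x \<in> {a<..<b}}"

definition profile :: "nat \<Rightarrow> real \<Rightarrow> real \<Rightarrow> real" where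
  "profile n R x = (THE y. \<exists>a b u. profile_solution n R a b u \<and> x \<in> {a<..<b} \<and> u x = y)"

(* u_R'(b) = -\<infinity> is the case F = at_bot, and u_R'(b) = +\<infinity> the case F = at_top. *)

definition vertical_at :: "real filter \<Rightarrow> nat \<Rightarrow> real \<Rightarrow> real \<Rightarrow> bool" where
  "vertical_at F n R b \<longleftrightarrow>
     0 < b \<and> {0..<b} \<subseteq> profile_dom n R \<and>
     filterlim (deriv (profile n R)) F (at_left b)"

(* V S = (b_S, u_S(b_S)) is a family of points of the (x,r)-plane. For bounded V, the condition
   says that V has a limit point on the axis r = 0 as S tends to R. *)

definition accumulates_on_axis :: "(real \<Rightarrow> real \<times> real) \<Rightarrow> real \<Rightarrow> bool" where
  "accumulates_on_axis V R \<longleftrightarrow> (\<forall>e>0. \<exists>\<^sub>F S in at R. \<bar>snd (V S)\<bar> < e)"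

definition escapes_to_infinity :: "(real \<Rightarrow> real \<times> real) \<Rightarrow> real \<Rightarrow> bool" where
  "escapes_to_infinity V R \<longleftrightarrow> \<not> Bfun V (at R)"

end

theory Submission
  imports Defs
begin

text \<open>
  Write \<open>h = u'' / (1 + u'\<^sup>2) = (arctan u')'\<close>, \<open>g = u * h\<close> and
  \<open>\<phi> = x + u * u'\<close>, which vanishes identically on the sphere. The function
  \<open>k = 2 * g' / (1 + u'\<^sup>2)\<close> satisfies the linear equation
  \<open>k' = x * (1 + u'\<^sup>2) / 2 * k + 2 * u' * h * \<phi> / (1 + u'\<^sup>2)\<close> with \<open>k 0 = 0\<close>,
  so \<open>g\<close> is monotone as long as \<open>u' * h * \<phi>\<close> keeps its sign. Above the sphere
  \<open>g\<close> starts below \<open>-1\<close> and \<open>\<phi>' = (1 + u'\<^sup>2) * (1 + g)\<close>, so \<open>g < -1\<close>, \<open>u' < 0\<close>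
  and \<open>\<phi> < 0\<close> propagate; below the cylinder \<open>g\<close> starts positive and increases. Hence
  \<open>u''\<close> never changes sign. The resulting lower bounds on the rate at which \<open>arctan u'\<close> changes,
  both in \<open>x\<close> and in \<open>u\<close>, force a vertical point after a bounded distance, and they bound
  the remaining piece of the curve by \<open>pi / 2 - arctan \<bar>u'\<bar>\<close> locally uniformly in \<open>R\<close>, so
  continuity follows from continuous dependence of the curve at a point before the vertical one.
\<close>

section \<open>Ordinary differential equations with a globally Lipschitz right-hand side\<close>

text \<open>\<open>g\<close> is calibrated on the two explicit solutions: it is constantly -1 on the
  sphere x^2 + u^2 = 2n and constantly 0 on the cylinder u^2 = 2(n - 1). As \<open>g 0\<close> = n -
  1 - R^2 / 2, the two ranges of \<open>R\<close> are exactly \<open>g 0 < -1\<close> and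
  \<open>g 0 > 0\<close>. The function \<phi> is half the derivative of x^2 + u^2. The equation for
  u is singular at a vertical point, so continuous dependence is available only before it. Moreover,
  a maximal solution leaves every box, but it might do so by running off to infinity or into the
  axis instead of becoming vertical. Above the sphere, \<phi> < 0 reads |u'| > x / u, so the axis
  cannot be approached with bounded slope. Below the cylinder, the point x - u / u' where the
  tangent meets the axis moves to the right; once it is positive it bounds h below by a multiple of
  u', so the curve turns vertical within finite length and height. The term (n - 1) / u opposes the
  turning only above the sphere, and this is why accumulation on the axis has to be excluded
  there.\<close>

lemma norm_bound_of_exp_derivative_bound:
  fixes K :: "real \<Rightarrow> 'a::real_normed_vector"
  assumes K: "\<And>s. (K has_vector_derivative K' s) (at s)" and K0: "K 0 = 0"
    and bound: "\<And>s. norm (K' s) \<le> c * exp (l * \<bar>s\<bar>)" and l: "l > 0"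
  shows "norm (K t) \<le> c / l * exp (l * \<bar>t\<bar>)"
proof -
  have c: "c \<ge> 0" using order_trans[OF norm_ge_zero bound[of 0]] by simp
  \<comment> \<open>The bound is integrated over nonnegative times only; negative times follow by
    reflecting \<open>K\<close>. The gained factor 1 / l is what later makes the Picard operator
    contract.\<close>
  have *: "norm (H t) \<le> c / l * exp (l * t)"
    if H: "\<And>s. (H has_vector_derivative H' s) (at s)" and H0: "H 0 = 0"
      and b: "\<And>s. 0 \<le> s \<Longrightarrow> norm (H' s) \<le> c * exp (l * s)" and t: "0 \<le> t"
    for H H' :: "real \<Rightarrow> 'a" and t
  proof (cases "t = 0")
    case True
    then show ?thesis using H0 c l by simp
  next
    case False
    have "norm (H t - H 0) \<le> c / l * exp (l * t) - c / l * exp (l * 0)"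
    proof (rule differentiable_bound_general[where f' = H' and \<phi>' = "\<lambda>s. c * exp (l * s)"])
      show "continuous_on {0..t} H"
        by (intro continuous_at_imp_continuous_on ballI has_vector_derivative_continuous[OF H])
      show "((\<lambda>s. c / l * exp (l * s)) has_vector_derivative c * exp (l * s)) (at s)" for s
        unfolding has_real_derivative_iff_has_vector_derivative[symmetric]
        using l by (auto intro!: derivative_eq_intros)
    qed (use False t H b l in \<open>auto intro!: continuous_intros\<close>)
    moreover have "c / l * exp (l * 0) \<ge> 0" using c l by simp
    ultimately show ?thesis using H0 by simp
  qed
  show ?thesis
  proof (cases "t \<ge> 0")
    case True
    have "norm (K t) \<le> c / l * exp (l * t)"
    proof (rule *[OF K K0 _ True])
      fix s :: real assume "0 \<le> s"
      then show "norm (K' s) \<le> c * exp (l * s)" using bound[of s] by simp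
    qed
    then show ?thesis using True by simp
  next
    case False
    have K_neg: "((K \<circ> uminus) has_vector_derivative (- 1) *\<^sub>R K' (- s)) (at s)" for s
    proof (rule vector_diff_chain_at)
      show "(uminus has_vector_derivative (- 1 :: real)) (at s)"
        by (auto intro!: derivative_eq_intros)
    qed (rule K)
    have "norm ((K \<circ> uminus) (- t)) \<le> c / l * exp (l * (- t))"
    proof (rule *[OF K_neg])
      fix s :: real assume "0 \<le> s"
      then show "norm ((- 1) *\<^sub>R K' (- s)) \<le> c * exp (l * s)"
        using bound[of "- s"] by simp
    qed (use False K0 in auto)
    then show ?thesis using False by simp
  qed
qed

text \<open>In the norm weighted by \<open>exp (- l * \<bar>t\<bar>)\<close> with \<open>l > 2 * L\<close>, the Picard operator
  is a contraction on the whole line at once, so no gluing of short intervals is needed.\<close>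

lemma picard_lindeloef_global:
  fixes f :: "real \<Rightarrow> 'a::euclidean_space \<Rightarrow> 'a"
  assumes cont: "\<And>y. continuous_on UNIV y \<Longrightarrow> continuous_on UNIV (\<lambda>s. f s (y s))"
    and bdd: "\<And>t y. norm (f t y) \<le> B"
    and lip: "\<And>t y z. norm (f t y - f t z) \<le> L * norm (y - z)"
  obtains y where "y 0 = y0" "\<And>t. (y has_vector_derivative f t (y t)) (at t)"
proof -
  \<comment> \<open>The summand 1 keeps \<open>l\<close> positive for \<open>L = 0\<close>; the
    ratio |L| / l \<le> 1 / 2 becomes the contraction constant.\<close>
  define l where "l = 2 * \<bar>L\<bar> + 1"
  have l: "l > 0" "\<bar>L\<bar> / l \<le> 1 / 2" by (auto simp: l_def divide_simps)
  have B: "B \<ge> 0" using order_trans[OF norm_ge_zero bdd] .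
  \<comment> \<open>Solutions may be unbounded, whereas the fixed point is sought among bounded
    continuous functions: the unknown \<open>\<psi>\<close> is the damped curve, and
    \<open>w \<psi>\<close> is the actual one.\<close>
  define w where "w \<psi> s = exp (l * \<bar>s\<bar>) *\<^sub>R apply_bcontfun \<psi> s" for \<psi> :: "real \<Rightarrow>\<^sub>C 'a" and s
  have contw: "continuous_on UNIV (w \<psi>)" for \<psi>
    unfolding w_def by (intro continuous_intros continuous_on_apply_bcontfun)
  have "\<exists>K. K 0 = 0 \<and> (\<forall>t. (K has_vector_derivative f t (w \<psi> t)) (at t))" for \<psi>
  proof -
    have "isCont (\<lambda>s. f s (w \<psi> s)) x" for x
      using cont[OF contw] by (simp add: continuous_on_eq_continuous_at)
    then obtain F where F: "\<And>x. (F has_vector_derivative f x (w \<psi> x)) (at x)"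
      using einterval_antiderivative[of "-\<infinity>" \<infinity> "\<lambda>s. f s (w \<psi> s)"] by auto
    have "((\<lambda>t. F t - F 0) has_vector_derivative f x (w \<psi> x)) (at x)" for x
      using F[of x] by (auto intro!: derivative_eq_intros)
    then show ?thesis by (intro exI[of _ "\<lambda>t. F t - F 0"]) auto
  qed
  then obtain K where K0: "\<And>\<psi>. K \<psi> 0 = 0"
    and K: "\<And>\<psi> t. (K \<psi> has_vector_derivative f t (w \<psi> t)) (at t)" by metis
  have contK: "continuous_on UNIV (K \<psi>)" for \<psi>
    by (intro continuous_at_imp_continuous_on ballI has_vector_derivative_continuous[OF K])
  have bK: "norm (K \<psi> t) \<le> B / l * exp (l * \<bar>t\<bar>)" for \<psi> t
  proof (rule norm_bound_of_exp_derivative_bound[OF K K0 _ l(1)])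
    fix s show "norm (f s (w \<psi> s)) \<le> B * exp (l * \<bar>s\<bar>)"
      using bdd[of s "w \<psi> s"] B l mult_left_mono[of 1 "exp (l * \<bar>s\<bar>)" B] by simp
  qed
  define \<Phi> where "\<Phi> \<psi> t = exp (- (l * \<bar>t\<bar>)) *\<^sub>R (y0 + K \<psi> t)" for \<psi> t
  have "\<Phi> \<psi> \<in> bcontfun" for \<psi>
  proof (rule bcontfun_normI)
    show "continuous_on UNIV (\<Phi> \<psi>)" unfolding \<Phi>_def by (intro continuous_intros contK)
    fix t
    have "norm (\<Phi> \<psi> t) = exp (- (l * \<bar>t\<bar>)) * norm (y0 + K \<psi> t)"
      by (simp add: \<Phi>_def)
    also have "\<dots> \<le> exp (- (l * \<bar>t\<bar>)) * (norm y0 + B / l * exp (l * \<bar>t\<bar>))"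
      by (intro mult_left_mono order_trans[OF norm_triangle_ineq] add_left_mono bK) auto
    also have "\<dots> = exp (- (l * \<bar>t\<bar>)) * norm y0 + B / l"
      by (simp add: algebra_simps exp_minus)
    also have "\<dots> \<le> norm y0 + B / l"
      using l mult_right_mono[of "exp (- (l * \<bar>t\<bar>))" 1 "norm y0"] by simp
    finally show "norm (\<Phi> \<psi> t) \<le> norm y0 + B / l" .
  qed
  then have app: "apply_bcontfun (Bcontfun (\<Phi> \<psi>)) = \<Phi> \<psi>" for \<psi>
    by (rule Bcontfun_inverse)
  have contraction: "dist (Bcontfun (\<Phi> \<psi>)) (Bcontfun (\<Phi> \<eta>)) \<le> 1 / 2 * dist \<psi> \<eta>" for \<psi> \<eta>
  proof (rule dist_bound)
    fix t
    have "norm (K \<psi> t - K \<eta> t) \<le> \<bar>L\<bar> * dist \<psi> \<eta> / l * exp (l * \<bar>t\<bar>)"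
    proof (rule norm_bound_of_exp_derivative_bound[where K = "\<lambda>t. K \<psi> t - K \<eta> t"])
      show "((\<lambda>t. K \<psi> t - K \<eta> t) has_vector_derivative f s (w \<psi> s) - f s (w \<eta> s)) (at s)" for s
        by (intro derivative_intros K)
      fix s
      have "norm (f s (w \<psi> s) - f s (w \<eta> s)) \<le> \<bar>L\<bar> * norm (w \<psi> s - w \<eta> s)"
        using lip[of s "w \<psi> s" "w \<eta> s"] mult_right_mono[OF abs_ge_self norm_ge_zero, of L "w \<psi> s - w \<eta> s"]
        by linarith
      also have "norm (w \<psi> s - w \<eta> s) = exp (l * \<bar>s\<bar>) * dist (apply_bcontfun \<psi> s) (apply_bcontfun \<eta> s)"
        by (simp add: w_def dist_norm scaleR_diff_right[symmetric])
      also have "\<bar>L\<bar> * \<dots> \<le> \<bar>L\<bar> * (exp (l * \<bar>s\<bar>) * dist \<psi> \<eta>)"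
        by (intro mult_left_mono dist_bounded) auto
      finally show "norm (f s (w \<psi> s) - f s (w \<eta> s)) \<le> \<bar>L\<bar> * dist \<psi> \<eta> * exp (l * \<bar>s\<bar>)"
        by (simp only: ac_simps)
    qed (use K0 l in auto)
    also have "\<dots> \<le> 1 / 2 * dist \<psi> \<eta> * exp (l * \<bar>t\<bar>)"
      using mult_right_mono[OF l(2), of "dist \<psi> \<eta> * exp (l * \<bar>t\<bar>)"] by simp
    finally have "exp (- (l * \<bar>t\<bar>)) * norm (K \<psi> t - K \<eta> t) \<le> 1 / 2 * dist \<psi> \<eta>"
      by (simp add: exp_minus divide_simps mult.commute)
    then show "dist (apply_bcontfun (Bcontfun (\<Phi> \<psi>)) t) (apply_bcontfun (Bcontfun (\<Phi> \<eta>)) t) \<le> 1 / 2 * dist \<psi> \<eta>"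
      by (simp add: app \<Phi>_def dist_norm scaleR_diff_right[symmetric])
  qed
  have "\<exists>!\<psi>. Bcontfun (\<Phi> \<psi>) = \<psi>"
    by (rule banach_fix_type[of "1 / 2"]) (use contraction in auto)
  then obtain \<psi> where \<psi>: "Bcontfun (\<Phi> \<psi>) = \<psi>" by blast
  have "w \<psi> t = y0 + K \<psi> t" for t
  proof -
    have "apply_bcontfun \<psi> t = \<Phi> \<psi> t" using app[of \<psi>] \<psi> by simp
    then show ?thesis unfolding w_def by (simp add: \<Phi>_def exp_minus)
  qed
  then have w: "w \<psi> = (\<lambda>t. y0 + K \<psi> t)" by blast
  show thesis
  proof
    show "(\<lambda>t. y0 + K \<psi> t) 0 = y0" using K0 by simp
    show "((\<lambda>t. y0 + K \<psi> t) has_vector_derivative f t (y0 + K \<psi> t)) (at t)" for t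
      using K[of \<psi> t] fun_cong[OF w, of t] by (auto intro!: derivative_eq_intros)
  qed
qed

text \<open>The weighted squared distance \<open>N\<close> does not increase, by Cauchy-Schwarz and
  the Lipschitz bound. Equal initial values yield uniqueness, different ones continuous
  dependence.\<close>

lemma gronwall_lipschitz:
  fixes y z :: "real \<Rightarrow> 'a::real_inner"
  assumes y: "\<And>t. 0 \<le> t \<Longrightarrow> t \<le> T \<Longrightarrow> (y has_vector_derivative f t (y t)) (at t)"
    and z: "\<And>t. 0 \<le> t \<Longrightarrow> t \<le> T \<Longrightarrow> (z has_vector_derivative f t (z t)) (at t)"
    and lip: "\<And>t y z. norm (f t y - f t z) \<le> L * norm (y - z)"
    and t: "0 \<le> t" "t \<le> T"
  shows "norm (y t - z t) \<le> norm (y 0 - z 0) * exp (L * t)"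
proof -
  \<comment> \<open>The norm is squared to stay differentiable where the two curves meet; the root
    is taken only at the end.\<close>
  define N where "N s = (norm (y s - z s))\<^sup>2 * exp (- 2 * L * s)" for s
  have N: "\<exists>D. (N has_real_derivative D) (at s) \<and> D \<le> 0" if s: "0 \<le> s" "s \<le> t" for s
  proof -
    define d e where "d = y s - z s" and "e = f s (y s) - f s (z s)"
    have "((\<lambda>s. y s - z s) has_vector_derivative e) (at s)"
      unfolding e_def using s t by (intro derivative_intros y z) auto
    then have "((\<lambda>s. (y s - z s) \<bullet> (y s - z s)) has_vector_derivative d \<bullet> e + e \<bullet> d) (at s)"
      unfolding d_def
      using bounded_bilinear.has_vector_derivative[OF bounded_bilinear_inner] by blast
    then have "((\<lambda>s. (norm (y s - z s))\<^sup>2) has_real_derivative 2 * (d \<bullet> e)) (at s)"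
      by (simp add: has_real_derivative_iff_has_vector_derivative power2_norm_eq_inner inner_commute)
    then have "(N has_real_derivative
        (2 * (d \<bullet> e) - 2 * L * (norm d)\<^sup>2) * exp (- 2 * L * s)) (at s)"
      unfolding N_def
      by (rule DERIV_cong[OF DERIV_mult]) (auto intro!: derivative_eq_intros simp: d_def algebra_simps)
    moreover have "d \<bullet> e \<le> norm d * (L * norm d)"
      using norm_cauchy_schwarz[of d e] lip[of s "y s" "z s"]
      unfolding d_def e_def by (meson mult_left_mono norm_ge_zero order_trans)
    then have "(2 * (d \<bullet> e) - 2 * L * (norm d)\<^sup>2) * exp (- 2 * L * s) \<le> 0"
      by (intro mult_nonpos_nonneg) (auto simp: power2_eq_square algebra_simps)
    ultimately show ?thesis by blast
  qed
  have "N t \<le> N 0"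
    using DERIV_nonpos_imp_nonincreasing[OF t(1), of N] N by blast
  then have "(norm (y t - z t))\<^sup>2 \<le> (norm (y 0 - z 0))\<^sup>2 * exp (2 * L * t)"
    by (simp add: N_def exp_minus divide_simps)
  also have "\<dots> = (norm (y 0 - z 0) * exp (L * t))\<^sup>2"
    by (simp add: power_mult_distrib exp_of_nat_mult[symmetric] power2_eq_square exp_add[symmetric])
  finally show ?thesis by (rule power2_le_imp_le) simp
qed

section \<open>The initial value problem for the profile curve\<close>

text \<open>Along a solution, \<open>angle_rate n x u u'\<close> is \<open>(arctan u')'\<close>, the \<open>h\<close> of the
  introduction; \<open>g = u * h\<close> is called \<open>scaled_angle_rate\<close> below.\<close>

definition angle_rate :: "nat \<Rightarrow> real \<Rightarrow> real \<Rightarrow> real \<Rightarrow> real" where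
  "angle_rate n x u v = (real n - 1) / u - u / 2 + x / 2 * v"

section \<open>Truncation of the first-order system to a box\<close>

definition clip :: "real \<Rightarrow> real \<Rightarrow> real" where
  "clip K v = max (- K) (min K v)"

text \<open>The lower cutoff 1 / K keeps the pole of (n - 1) / u out of reach, so that a single
  parameter \<open>K\<close> can bound position, slope, and height from both sides.\<close>

definition clip_pos :: "real \<Rightarrow> real \<Rightarrow> real" where
  "clip_pos K u = max (1 / K) (min K u)"

definition in_box :: "real \<Rightarrow> real \<Rightarrow> real \<Rightarrow> real \<Rightarrow> bool" where
  "in_box K x u v \<longleftrightarrow> \<bar>x\<bar> \<le> K \<and> 1 / K \<le> u \<and> u \<le> K \<and> \<bar>v\<bar> \<le> K"

text \<open>The first-order system \<open>u' = v\<close>, \<open>v' = (1 + v\<^sup>2) * angle_rate n x u v\<close>, made bounded and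
  globally Lipschitz by clipping all its arguments to a box.\<close>

definition clipped_field :: "nat \<Rightarrow> real \<Rightarrow> real \<Rightarrow> real \<times> real \<Rightarrow> real \<times> real" where
  "clipped_field n K x p = (clip K (snd p),
     (1 + (clip K (snd p))\<^sup>2) * angle_rate n (clip K x) (clip_pos K (fst p)) (clip K (snd p)))"

lemma clip_bound: "K \<ge> 0 \<Longrightarrow> \<bar>clip K v\<bar> \<le> K"
  by (auto simp: clip_def)

lemma clip_pos_bound: "K \<ge> 1 \<Longrightarrow> 1 / K \<le> clip_pos K u \<and> clip_pos K u \<le> K"
  using mult_mono[of 1 K 1 K] by (auto simp: clip_pos_def divide_simps)

lemma clip_lipschitz: "\<bar>clip K v - clip K w\<bar> \<le> \<bar>v - w\<bar>"
  and clip_pos_lipschitz: "\<bar>clip_pos K v - clip_pos K w\<bar> \<le> \<bar>v - w\<bar>"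
  by (auto simp: clip_def clip_pos_def)

lemma clipped_field_eq:
  "in_box K x u v \<Longrightarrow> clipped_field n K x (u, v) = (v, (1 + v\<^sup>2) * angle_rate n x u v)"
  by (auto simp: in_box_def clipped_field_def clip_def clip_pos_def)

lemma angle_rate_bound:
  assumes "K \<ge> 1" "in_box K x u v"
  shows "\<bar>angle_rate n x u v\<bar> \<le> \<bar>real n - 1\<bar> * K + K + K * K"
proof -
  have u: "1 / K \<le> u" "0 < u" "u \<le> K"
    using assms by (auto simp: in_box_def intro: less_le_trans[of 0 "1 / K"])
  have "1 / u \<le> K" using u assms(1) by (simp add: divide_simps mult.commute)
  then have "\<bar>(real n - 1) / u\<bar> \<le> \<bar>real n - 1\<bar> * K"
    using mult_left_mono[of "1 / u" K "\<bar>real n - 1\<bar>"] u by (simp add: abs_divide)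
  moreover have "\<bar>x * v\<bar> \<le> K * K"
    unfolding abs_mult using assms by (intro mult_mono) (auto simp: in_box_def)
  moreover have "angle_rate n x u v = (real n - 1) / u - u / 2 + (x * v) / 2"
    by (simp add: angle_rate_def)
  ultimately show ?thesis using u by linarith
qed

lemma angle_rate_lipschitz:
  assumes K: "K \<ge> 1" and b: "in_box K x u v" "in_box K x u' v'"
  shows "\<bar>angle_rate n x u v - angle_rate n x u' v'\<bar>
    \<le> (\<bar>real n - 1\<bar> * (K * K) + 1) * \<bar>u - u'\<bar> + K * \<bar>v - v'\<bar>"
proof -
  have u: "1 / K \<le> u" "0 < u" "1 / K \<le> u'" "0 < u'"
    using assms by (auto simp: in_box_def intro: less_le_trans[of 0 "1 / K"])
  have "1 / u \<le> K" "1 / u' \<le> K" using u K by (simp_all add: divide_simps mult.commute)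
  then have "1 / u * (1 / u') \<le> K * K" using u K by (intro mult_mono) auto
  then have "\<bar>u - u'\<bar> * (1 / u * (1 / u')) \<le> \<bar>u - u'\<bar> * (K * K)"
    by (intro mult_left_mono) auto
  moreover have "1 / u - 1 / u' = (u' - u) * (1 / u * (1 / u'))"
    using u by (simp add: field_simps)
  then have "\<bar>1 / u - 1 / u'\<bar> = \<bar>u - u'\<bar> * (1 / u * (1 / u'))"
    using u by (simp add: abs_mult abs_minus_commute)
  ultimately have "\<bar>real n - 1\<bar> * \<bar>1 / u - 1 / u'\<bar> \<le> \<bar>real n - 1\<bar> * (\<bar>u - u'\<bar> * (K * K))"
    by (intro mult_left_mono) auto
  then have 1: "\<bar>(real n - 1) / u - (real n - 1) / u'\<bar> \<le> \<bar>real n - 1\<bar> * (K * K) * \<bar>u - u'\<bar>"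
    unfolding abs_mult[symmetric] by (simp add: field_simps)
  have 2: "\<bar>x * (v - v')\<bar> \<le> K * \<bar>v - v'\<bar>"
    unfolding abs_mult using b by (intro mult_right_mono) (auto simp: in_box_def)
  have "angle_rate n x u v - angle_rate n x u' v'
      = ((real n - 1) / u - (real n - 1) / u') - (u - u') / 2 + x * (v - v') / 2"
    by (simp add: angle_rate_def field_simps)
  moreover have "\<bar>p - q / 2 + r / 2\<bar> \<le> \<bar>p\<bar> + \<bar>q\<bar> + \<bar>r\<bar>" for p q r :: real by linarith
  ultimately have "\<bar>angle_rate n x u v - angle_rate n x u' v'\<bar>
      \<le> \<bar>(real n - 1) / u - (real n - 1) / u'\<bar> + \<bar>u - u'\<bar> + \<bar>x * (v - v')\<bar>"
    by metis
  also have "\<dots> \<le> \<bar>real n - 1\<bar> * (K * K) * \<bar>u - u'\<bar> + \<bar>u - u'\<bar> + K * \<bar>v - v'\<bar>"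
    by (intro add_mono 1 2 order.refl)
  finally show ?thesis by (simp add: distrib_right)
qed

lemma in_box_clip: "K \<ge> 1 \<Longrightarrow> in_box K (clip K x) (clip_pos K u) (clip K v)"
  using clip_bound[of K] clip_pos_bound[of K] by (auto simp: in_box_def)

lemma clipped_field_bound:
  assumes "K \<ge> 1"
  shows "norm (clipped_field n K x p)
    \<le> K + (1 + K\<^sup>2) * (\<bar>real n - 1\<bar> * K + K + K * K)"
proof -
  let ?v = "clip K (snd p)" and ?h = "angle_rate n (clip K x) (clip_pos K (fst p)) (clip K (snd p))"
  have "?v\<^sup>2 \<le> K\<^sup>2" using clip_bound[of K "snd p"] assms by (intro abs_le_square_iff[THEN iffD1]) simp
  then have "\<bar>(1 + ?v\<^sup>2) * ?h\<bar> \<le> (1 + K\<^sup>2) * (\<bar>real n - 1\<bar> * K + K + K * K)"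
    unfolding abs_mult using angle_rate_bound[OF assms in_box_clip[OF assms]]
    by (intro mult_mono) auto
  moreover have "norm (clipped_field n K x p) \<le> \<bar>?v\<bar> + \<bar>(1 + ?v\<^sup>2) * ?h\<bar>"
    unfolding clipped_field_def by (rule order_trans[OF norm_Pair_le]) simp
  moreover have "\<bar>?v\<bar> \<le> K" using clip_bound[of K "snd p"] assms by simp
  ultimately show ?thesis by linarith
qed

lemma clipped_field_lipschitz:
  assumes K: "K \<ge> 1"
  obtains L where "\<And>x p q. norm (clipped_field n K x p - clipped_field n K x q) \<le> L * norm (p - q)"
proof
  define C where "C = \<bar>real n - 1\<bar> * K + K + K * K"
  define A where "A = \<bar>real n - 1\<bar> * (K * K) + 1"
  have pos: "C \<ge> 0" "A \<ge> 0" using K by (auto simp: A_def C_def)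
  fix x and p q :: "real \<times> real"
  define v w where "v = clip K (snd p)" and "w = clip K (snd q)"
  define h k where "h = angle_rate n (clip K x) (clip_pos K (fst p)) v"
    and "k = angle_rate n (clip K x) (clip_pos K (fst q)) w"
  let ?d = "norm (p - q)"
  have fst: "\<bar>fst p - fst q\<bar> \<le> ?d" and snd: "\<bar>snd p - snd q\<bar> \<le> ?d"
    using norm_fst_le[of "fst (p - q)" "snd (p - q)"] norm_snd_le[of "snd (p - q)" "fst (p - q)"] by (simp_all add: minus_prod_def)
  have vw: "\<bar>v - w\<bar> \<le> ?d" using clip_lipschitz snd unfolding v_def w_def by (rule order_trans)
  have uu: "\<bar>clip_pos K (fst p) - clip_pos K (fst q)\<bar> \<le> ?d"
    using clip_pos_lipschitz fst by (rule order_trans)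
  have v: "\<bar>v\<bar> \<le> K" "\<bar>w\<bar> \<le> K" using clip_bound K by (auto simp: v_def w_def)
  have k: "\<bar>k\<bar> \<le> C" unfolding k_def w_def C_def by (rule angle_rate_bound[OF K in_box_clip[OF K]])
  have "\<bar>h - k\<bar> \<le> A * \<bar>clip_pos K (fst p) - clip_pos K (fst q)\<bar> + K * \<bar>v - w\<bar>"
    unfolding h_def k_def v_def w_def A_def
    by (rule angle_rate_lipschitz[OF K in_box_clip[OF K] in_box_clip[OF K]])
  also have "\<dots> \<le> A * ?d + K * ?d"
    using uu vw pos K by (intro add_mono mult_left_mono) auto
  finally have hk: "\<bar>h - k\<bar> \<le> (A + K) * ?d" by (simp add: distrib_right)
  have v2: "v\<^sup>2 \<le> K\<^sup>2" using v K by (intro abs_le_square_iff[THEN iffD1]) simp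
  have "\<bar>(1 + v\<^sup>2) * (h - k)\<bar> \<le> (1 + K\<^sup>2) * ((A + K) * ?d)"
    unfolding abs_mult using v2 hk pos K by (intro mult_mono) auto
  moreover have "\<bar>(v + w) * (v - w) * k\<bar> \<le> (2 * K) * ?d * C"
    unfolding abs_mult using v vw k pos K by (intro mult_mono) auto
  moreover have "(1 + v\<^sup>2) * h - (1 + w\<^sup>2) * k = (1 + v\<^sup>2) * (h - k) + (v + w) * (v - w) * k"
    by (simp add: algebra_simps power2_eq_square)
  ultimately have "\<bar>(1 + v\<^sup>2) * h - (1 + w\<^sup>2) * k\<bar>
      \<le> (1 + K\<^sup>2) * ((A + K) * ?d) + (2 * K) * ?d * C" by linarith
  moreover have "norm (clipped_field n K x p - clipped_field n K x q)
      \<le> \<bar>v - w\<bar> + \<bar>(1 + v\<^sup>2) * h - (1 + w\<^sup>2) * k\<bar>"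
    using norm_Pair_le[of "v - w" "(1 + v\<^sup>2) * h - (1 + w\<^sup>2) * k"]
    by (simp add: clipped_field_def v_def w_def h_def k_def)
  ultimately have "norm (clipped_field n K x p - clipped_field n K x q)
      \<le> ?d + ((1 + K\<^sup>2) * ((A + K) * ?d) + (2 * K) * ?d * C)" using vw by linarith
  then show "norm (clipped_field n K x p - clipped_field n K x q)
      \<le> (1 + (1 + K\<^sup>2) * (A + K) + 2 * K * C) * ?d"
    by (simp add: algebra_simps)
qed

definition clipped_solution :: "nat \<Rightarrow> real \<Rightarrow> real \<Rightarrow> (real \<Rightarrow> real) \<Rightarrow> (real \<Rightarrow> real) \<Rightarrow> bool" where
  "clipped_solution n K R u v \<longleftrightarrow> u 0 = R \<and> v 0 = 0 \<and>
     (\<forall>x. ((\<lambda>x. (u x, v x)) has_vector_derivative clipped_field n K x (u x, v x)) (at x))"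

lemma clipped_solution_exists:
  assumes K: "K \<ge> 1"
  obtains u v where "clipped_solution n K R u v"
proof -
  obtain L where L: "\<And>x p q. norm (clipped_field n K x p - clipped_field n K x q) \<le> L * norm (p - q)"
    using clipped_field_lipschitz[OF K] by blast
  have cont: "continuous_on UNIV (\<lambda>s. clipped_field n K s (y s))"
    if y: "continuous_on UNIV y" for y
  proof -
    have "clip_pos K u \<noteq> 0" for u using clip_pos_bound[OF K, of u] K by auto
    then show ?thesis
      unfolding clipped_field_def angle_rate_def
      by (intro continuous_intros) (auto simp: clip_def clip_pos_def intro!: continuous_intros y)
  qed
  obtain y where y: "y 0 = (R, 0)"
      "\<And>t. (y has_vector_derivative clipped_field n K t (y t)) (at t)"
    using picard_lindeloef_global[of "clipped_field n K", OF cont clipped_field_bound[OF K] L] by blast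
  have "clipped_solution n K R (\<lambda>x. fst (y x)) (\<lambda>x. snd (y x))"
    using y by (simp add: clipped_solution_def)
  then show thesis by (rule that)
qed

lemma clipped_solution_continuous:
  assumes "clipped_solution n K R u v"
  shows "continuous_on A u" "continuous_on A v"
proof -
  have "continuous_on A (\<lambda>x. (u x, v x))"
    using assms by (intro continuous_at_imp_continuous_on ballI)
      (auto simp: clipped_solution_def intro: has_vector_derivative_continuous)
  from continuous_on_fst[OF this] continuous_on_snd[OF this]
  show "continuous_on A u" "continuous_on A v" by simp_all
qed

lemma clipped_solution_deriv:
  assumes "clipped_solution n K R u v" "in_box K x (u x) (v x)"
  shows "(u has_real_derivative v x) (at x)"
    and "(v has_real_derivative (1 + (v x)\<^sup>2) * angle_rate n x (u x) (v x)) (at x)"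
proof -
  have "((\<lambda>x. (u x, v x)) has_vector_derivative (v x, (1 + (v x)\<^sup>2) * angle_rate n x (u x) (v x))) (at x)"
    using assms(1) unfolding clipped_solution_def clipped_field_eq[OF assms(2), of n, symmetric] by blast
  from bounded_linear.has_vector_derivative[OF bounded_linear_fst this]
    bounded_linear.has_vector_derivative[OF bounded_linear_snd this]
  show "(u has_real_derivative v x) (at x)"
    and "(v has_real_derivative (1 + (v x)\<^sup>2) * angle_rate n x (u x) (v x)) (at x)"
    by (simp_all add: has_real_derivative_iff_has_vector_derivative)
qed

section \<open>Solutions of the equation compared with solutions of the truncated system\<close>

lemma profile_solutionD:
  assumes "profile_solution n R a b u" "x \<in> {a<..<b}"
  shows "u x > 0" "(u has_real_derivative deriv u x) (at x)"
    "(deriv u has_real_derivative (1 + (deriv u x)\<^sup>2) * angle_rate n x (u x) (deriv u x)) (at x)"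
proof -
  have W: "1 + (deriv u x)\<^sup>2 \<noteq> 0" by (simp add: add_nonneg_eq_0_iff)
  from assms show "u x > 0" "(u has_real_derivative deriv u x) (at x)"
    by (auto simp: profile_solution_def DERIV_deriv_iff_real_differentiable)
  have "(deriv u has_real_derivative deriv (deriv u) x) (at x)"
    using assms by (auto simp: profile_solution_def DERIV_deriv_iff_real_differentiable)
  moreover have "deriv (deriv u) x / (1 + (deriv u x)\<^sup>2) = angle_rate n x (u x) (deriv u x)"
    using assms by (auto simp: profile_solution_def angle_rate_def)
  then have "deriv (deriv u) x = (1 + (deriv u x)\<^sup>2) * angle_rate n x (u x) (deriv u x)"
    using W by (simp add: divide_simps mult.commute split: if_splits)
  ultimately show "(deriv u has_real_derivative (1 + (deriv u x)\<^sup>2) * angle_rate n x (u x) (deriv u x)) (at x)"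
    by simp
qed

lemma profile_solutionI:
  assumes "a < 0" "0 < b" "u 0 = R" "v 0 = 0"
    and sol: "\<And>x. x \<in> {a<..<b} \<Longrightarrow> u x > 0 \<and> (u has_real_derivative v x) (at x) \<and>
      (v has_real_derivative (1 + (v x)\<^sup>2) * angle_rate n x (u x) (v x)) (at x)"
  shows "profile_solution n R a b u" "\<And>x. x \<in> {a<..<b} \<Longrightarrow> deriv u x = v x"
proof -
  show d: "deriv u x = v x" if "x \<in> {a<..<b}" for x
    using sol[OF that] by (auto intro: DERIV_imp_deriv)
  have dd: "(deriv u has_real_derivative (1 + (v x)\<^sup>2) * angle_rate n x (u x) (v x)) (at x)"
    if x: "x \<in> {a<..<b}" for x
    using sol[OF x] x by (auto intro: has_field_derivative_transform_within_open[of v _ x "{a<..<b}"] simp: d)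
  show "profile_solution n R a b u"
    unfolding profile_solution_def
  proof (intro conjI ballI)
    show "deriv u 0 = 0" using d[of 0] assms(1,2,4) by simp
    fix x assume x: "x \<in> {a<..<b}"
    show "u x > 0" using sol[OF x] by blast
    show "u differentiable at x" "deriv u differentiable at x"
      using sol[OF x] dd[OF x] real_differentiable_def by blast+
    have "1 + (v x)\<^sup>2 \<noteq> 0" by (simp add: add_nonneg_eq_0_iff)
    then show "deriv (deriv u) x / (1 + (deriv u x)\<^sup>2) =
        (real n - 1) / u x - u x / 2 + x / 2 * deriv u x"
      unfolding DERIV_imp_deriv[OF dd[OF x]] d[OF x] angle_rate_def by simp
  qed (use assms in auto)
qed

text \<open>The strict bounds on [0, x1] are open conditions, so they persist a little to the left
  of 0 and to the right of \<open>x1\<close>. This supplies the open interval that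
  \<open>profile_solution\<close> demands, and inside the box the clipping has no effect.\<close>

lemma clipped_solution_imp_profile_solution:
  assumes sol: "clipped_solution n K R u v" and x1: "0 \<le> x1" and K: "K \<ge> 1"
    and box: "\<And>x. 0 \<le> x \<Longrightarrow> x \<le> x1 \<Longrightarrow> x < K \<and> 1 / K < u x \<and> u x < K \<and> \<bar>v x\<bar> < K"
  obtains a b where "a < 0" "x1 < b" "profile_solution n R a b u"
    "\<And>x. x \<in> {a<..<b} \<Longrightarrow> deriv u x = v x"
proof -
  define G where "G = {x. \<bar>x\<bar> < K \<and> 1 / K < u x \<and> u x < K \<and> \<bar>v x\<bar> < K}"
  have "open G" unfolding G_def using clipped_solution_continuous[OF sol]
    by (intro open_Collect_conj open_Collect_less continuous_intros) auto
  moreover have "0 \<in> G" "x1 \<in> G" using box[of 0] box[of x1] x1 by (auto simp: G_def)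
  ultimately obtain e1 e2 where e: "e1 > 0" "ball 0 e1 \<subseteq> G" "e2 > 0" "ball x1 e2 \<subseteq> G"
    by (meson open_contains_ball)
  have "x \<in> G" if "x \<in> {- e1<..<x1 + e2}" for x
  proof -
    consider "x < 0" | "0 \<le> x" "x \<le> x1" | "x1 < x" by linarith
    then show ?thesis
    proof cases
      case 1 then have "x \<in> ball 0 e1" using that by (auto simp: dist_real_def)
      then show ?thesis using e by blast
    next
      case 2 then show ?thesis using box[of x] by (auto simp: G_def)
    next
      case 3 then have "x \<in> ball x1 e2" using that by (auto simp: dist_real_def)
      then show ?thesis using e by blast
    qed
  qed
  then have inb: "in_box K x (u x) (v x)" if "x \<in> {- e1<..<x1 + e2}" for x
    using that by (fastforce simp: G_def in_box_def)
  have "u x > 0" if "x \<in> {- e1<..<x1 + e2}" for x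
  proof -
    have "0 < 1 / K" using K by simp
    also have "\<dots> \<le> u x" using inb[OF that] by (simp add: in_box_def)
    finally show ?thesis .
  qed
  then have s: "u x > 0 \<and> (u has_real_derivative v x) (at x) \<and>
      (v has_real_derivative (1 + (v x)\<^sup>2) * angle_rate n x (u x) (v x)) (at x)"
    if "x \<in> {- e1<..<x1 + e2}" for x
    using that clipped_solution_deriv[OF sol inb] by blast
  have "- e1 < 0" "0 < x1 + e2" "u 0 = R" "v 0 = 0"
    using e x1 sol by (auto simp: clipped_solution_def)
  from profile_solutionI[OF this s] show thesis using e by (intro that[of "- e1" "x1 + e2"]) auto
qed

text \<open>While the profile curve stays in the box it solves the truncated system too, so Gronwall
  compares it with any clipped solution; \<open>U\<close> and \<open>V\<close> may leave the box.
  For \<open>R = S\<close> the curves coincide.\<close>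

lemma profile_solution_near_clipped_solution:
  assumes u: "profile_solution n R a b u" and x1: "x1 < b"
    and box: "\<And>x. 0 \<le> x \<Longrightarrow> x \<le> x1 \<Longrightarrow> in_box K x (u x) (deriv u x)"
    and sol: "clipped_solution n K S U V"
    and lip: "\<And>x p q. norm (clipped_field n K x p - clipped_field n K x q) \<le> L * norm (p - q)"
    and x: "0 \<le> x" "x \<le> x1"
  shows "\<bar>u x - U x\<bar> \<le> \<bar>R - S\<bar> * exp (L * x)" "\<bar>deriv u x - V x\<bar> \<le> \<bar>R - S\<bar> * exp (L * x)"
proof -
  have a: "a < 0" "u 0 = R" "deriv u 0 = 0" using u by (auto simp: profile_solution_def)
  have "norm ((u x, deriv u x) - (U x, V x)) \<le> norm ((u 0, deriv u 0) - (U 0, V 0)) * exp (L * x)"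
  proof (rule gronwall_lipschitz[where f = "clipped_field n K" and T = x1])
    fix t assume t: "0 \<le> t" "t \<le> x1"
    then have "t \<in> {a<..<b}" using a x1 by auto
    from profile_solutionD(2,3)[OF u this]
    show "((\<lambda>x. (u x, deriv u x)) has_vector_derivative clipped_field n K t (u t, deriv u t)) (at t)"
      unfolding clipped_field_eq[OF box[OF t]] has_real_derivative_iff_has_vector_derivative
      by (rule has_vector_derivative_Pair)
    show "((\<lambda>x. (U x, V x)) has_vector_derivative clipped_field n K t (U t, V t)) (at t)"
      using sol by (simp add: clipped_solution_def)
  qed (use lip x in auto)
  also have "norm ((u 0, deriv u 0) - (U 0, V 0)) = \<bar>R - S\<bar>"
    using a sol by (simp add: clipped_solution_def norm_Pair)
  finally have "norm (u x - U x, deriv u x - V x) \<le> \<bar>R - S\<bar> * exp (L * x)" by simp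
  moreover have "\<bar>u x - U x\<bar> \<le> norm (u x - U x, deriv u x - V x)"
    "\<bar>deriv u x - V x\<bar> \<le> norm (u x - U x, deriv u x - V x)"
    using norm_fst_le[of "u x - U x" "deriv u x - V x"]
      norm_snd_le[of "deriv u x - V x" "u x - U x"] by auto
  ultimately show "\<bar>u x - U x\<bar> \<le> \<bar>R - S\<bar> * exp (L * x)"
    "\<bar>deriv u x - V x\<bar> \<le> \<bar>R - S\<bar> * exp (L * x)" by auto
qed

lemma profile_solution_bounds:
  assumes u: "profile_solution n R a b u" and x1: "0 \<le> x1" "x1 < b"
  obtains m M where "m > 0" "\<And>x. 0 \<le> x \<Longrightarrow> x \<le> x1 \<Longrightarrow> m \<le> u x \<and> u x \<le> M \<and> \<bar>deriv u x\<bar> \<le> M"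
proof -
  have mem: "x \<in> {a<..<b}" if "x \<in> {0..x1}" for x
    using that u x1 by (auto simp: profile_solution_def)
  have c: "continuous_on {0..x1} u" "continuous_on {0..x1} (deriv u)"
    by (intro continuous_at_imp_continuous_on ballI DERIV_isCont[OF profile_solutionD(2)[OF u mem]]
        DERIV_isCont[OF profile_solutionD(3)[OF u mem]]; assumption)+
  have "{0..x1} \<noteq> {}" using x1 by auto
  from continuous_attains_inf[OF compact_Icc this c(1)] continuous_attains_sup[OF compact_Icc this c(1)]
    continuous_attains_sup[OF compact_Icc this, of "\<lambda>x. \<bar>deriv u x\<bar>"]
  obtain p q r where p: "p \<in> {0..x1}" "\<And>x. x \<in> {0..x1} \<Longrightarrow> u p \<le> u x"
    and q: "\<And>x. x \<in> {0..x1} \<Longrightarrow> u x \<le> u q"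
    and r: "\<And>x. x \<in> {0..x1} \<Longrightarrow> \<bar>deriv u x\<bar> \<le> \<bar>deriv u r\<bar>"
    using continuous_on_rabs[OF c(2)] by metis
  have "u p > 0" using profile_solutionD(1)[OF u mem[OF p(1)]] .
  then show thesis
  proof (rule that[of _ "max (u q) \<bar>deriv u r\<bar>"])
    fix x assume "0 \<le> x" "x \<le> x1"
    then show "u p \<le> u x \<and> u x \<le> max (u q) \<bar>deriv u r\<bar> \<and> \<bar>deriv u x\<bar> \<le> max (u q) \<bar>deriv u r\<bar>"
      using p(2)[of x] q[of x] r[of x] by (auto simp: max_def)
  qed
qed

text \<open>On [0, x] both solutions stay in one common box, so both coincide with the same clipped
  solution.\<close>

lemma profile_solution_unique:
  assumes "profile_solution n R a b u" "profile_solution n R a' b' u'" "0 \<le> x" "x < b" "x < b'"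
  shows "u x = u' x"
proof -
  obtain m M where m: "m > 0" "\<And>s. 0 \<le> s \<Longrightarrow> s \<le> x \<Longrightarrow> m \<le> u s \<and> u s \<le> M \<and> \<bar>deriv u s\<bar> \<le> M"
    using profile_solution_bounds[OF assms(1,3,4)] by blast
  obtain m' M' where m': "m' > 0" "\<And>s. 0 \<le> s \<Longrightarrow> s \<le> x \<Longrightarrow> m' \<le> u' s \<and> u' s \<le> M' \<and> \<bar>deriv u' s\<bar> \<le> M'"
    using profile_solution_bounds[OF assms(2,3,5)] by blast
  define K where "K = Max {1, x, M, M', 1 / m, 1 / m'}"
  have K: "1 \<le> K" "x \<le> K" "M \<le> K" "M' \<le> K" "1 / m \<le> K" "1 / m' \<le> K"
    unfolding K_def by (auto intro: Max_ge)
  then have mK: "1 / K \<le> m" "1 / K \<le> m'" using m m' by (simp_all add: divide_simps mult.commute)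
  have box: "in_box K s (u s) (deriv u s)" "in_box K s (u' s) (deriv u' s)" if "0 \<le> s" "s \<le> x" for s
    using m(2)[OF that] m'(2)[OF that] K mK that by (auto simp: in_box_def)
  obtain L where L: "\<And>x p q. norm (clipped_field n K x p - clipped_field n K x q) \<le> L * norm (p - q)"
    using clipped_field_lipschitz[OF K(1)] by blast
  obtain U V where UV: "clipped_solution n K R U V"
    using clipped_solution_exists[OF K(1)] by blast
  have "u x = U x" "u' x = U x"
    using profile_solution_near_clipped_solution(1)[OF assms(1,4) box(1) UV L assms(3)]
      profile_solution_near_clipped_solution(1)[OF assms(2,5) box(2) UV L assms(3)] by auto
  then show ?thesis by simp
qed

section \<open>The maximal solution: domain, derivatives, blow-up, stability\<close>

lemma profile_eq:
  assumes "profile_solution n R a b u" "0 \<le> x" "x < b"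
  shows "profile n R x = u x"
  unfolding profile_def
proof (rule the_equality)
  show "\<exists>a b w. profile_solution n R a b w \<and> x \<in> {a<..<b} \<and> w x = u x"
    using assms by (intro exI[of _ a] exI[of _ b] exI[of _ u]) (auto simp: profile_solution_def)
qed (use profile_solution_unique[OF _ assms(1,2) _ assms(3)] in auto)

lemma profile_dom_iff:
  assumes "0 \<le> x"
  shows "x \<in> profile_dom n R \<longleftrightarrow> (\<exists>a b u. profile_solution n R a b u \<and> x < b)"
proof -
  have "a < 0" if "profile_solution n R a b u" for a b u
    using that by (simp add: profile_solution_def)
  then show ?thesis using assms unfolding profile_dom_def by force
qed

text \<open>The inequality \<open>0 < x\<close> is strict because \<open>profile\<close> has been
  identified with \<open>u\<close> only for nonnegative arguments, and a derivative needs a whole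
  neighbourhood.\<close>

lemma deriv_profile_eq:
  assumes "profile_solution n R a b u" "0 < x" "x < b"
  shows "deriv (profile n R) x = deriv u x"
proof -
  have "(u has_real_derivative deriv u x) (at x)"
    using assms by (intro profile_solutionD(2)[OF assms(1)]) (auto simp: profile_solution_def)
  then have "(profile n R has_real_derivative deriv u x) (at x)"
    by (rule has_field_derivative_transform_within_open[of u _ x "{0<..<b}"])
      (use assms profile_eq[OF assms(1)] in auto)
  then show ?thesis by (rule DERIV_imp_deriv)
qed

lemma profile_derivs:
  assumes "0 < x" "x \<in> profile_dom n R"
  shows "profile n R x > 0" "(profile n R has_real_derivative deriv (profile n R) x) (at x)"
    "(deriv (profile n R) has_real_derivative (1 + (deriv (profile n R) x)\<^sup>2) *
       angle_rate n x (profile n R x) (deriv (profile n R) x)) (at x)"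
proof -
  obtain a b u where u: "profile_solution n R a b u" "x < b"
    using assms profile_dom_iff[of x] by auto
  have x: "x \<in> {a<..<b}" using assms u by (auto simp: profile_solution_def)
  note p = profile_eq[OF u(1)] deriv_profile_eq[OF u(1)]
  note d = profile_solutionD[OF u(1) x]
  show "profile n R x > 0" using d(1) p(1)[of x] assms u by simp
  show "(profile n R has_real_derivative deriv (profile n R) x) (at x)"
    unfolding p(2)[OF assms(1) u(2)]
    by (rule has_field_derivative_transform_within_open[OF d(2), of "{0<..<b}"])
      (use assms u p in auto)
  have "(deriv (profile n R) has_real_derivative (1 + (deriv u x)\<^sup>2) * angle_rate n x (u x) (deriv u x)) (at x)"
    by (rule has_field_derivative_transform_within_open[OF d(3), of "{0<..<b}"])
      (use assms u p in auto)
  then show "(deriv (profile n R) has_real_derivative (1 + (deriv (profile n R) x)\<^sup>2) *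
       angle_rate n x (profile n R x) (deriv (profile n R) x)) (at x)"
    using p(1)[of x] p(2)[of x] assms u by simp
qed

lemma profile_dom_downward:
  assumes "0 \<le> y" "y \<le> x" "x \<in> profile_dom n R"
  shows "y \<in> profile_dom n R"
  using assms profile_dom_iff[of x n R] profile_dom_iff[of y n R] by fastforce

lemma profile_dom_open:
  assumes "0 \<le> x" "x \<in> profile_dom n R"
  obtains y where "x < y" "y \<in> profile_dom n R"
proof -
  obtain a b u where u: "profile_solution n R a b u" "x < b"
    using assms profile_dom_iff[of x] by auto
  then have "(x + b) / 2 < b" "x < (x + b) / 2" "0 \<le> (x + b) / 2" using assms by auto
  then have "(x + b) / 2 \<in> profile_dom n R" using u profile_dom_iff by blast
  then show thesis using \<open>x < (x + b) / 2\<close> that by blast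
qed

lemma zero_in_profile_dom:
  assumes "R > 0"
  shows "0 \<in> profile_dom n R"
proof -
  define K where "K = max 1 (max R (1 / R)) + 1"
  have K: "K \<ge> 1" "R < K" "1 / R < K" by (auto simp: K_def)
  then have "1 / K < R" using assms by (simp add: divide_simps mult.commute)
  obtain U V where UV: "clipped_solution n K R U V" using clipped_solution_exists[OF K(1)] by blast
  have "x < K \<and> 1 / K < U x \<and> U x < K \<and> \<bar>V x\<bar> < K" if "0 \<le> x" "x \<le> 0" for x
    using that UV K \<open>1 / K < R\<close> by (auto simp: clipped_solution_def)
  from clipped_solution_imp_profile_solution[OF UV order.refl K(1) this]
  obtain a b where "0 < b" "profile_solution n R a b U" by blast
  then show ?thesis using profile_dom_iff[of 0] by blast
qed

text \<open>The blow-up alternative: a solution trapped in the box would have a bounded domain and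
  would agree there with a clipped solution, which exists on the whole line and would continue it
  past the supremum of that domain.\<close>

lemma profile_leaves_box:
  assumes R: "R > 0"
  obtains x where "0 < x" "x \<in> profile_dom n R" "\<not> in_box K x (profile n R x) (deriv (profile n R) x)"
proof -
  have False
    if inb: "\<And>x. 0 < x \<Longrightarrow> x \<in> profile_dom n R \<Longrightarrow> in_box K x (profile n R x) (deriv (profile n R) x)"
  proof -
    define D where "D = {x. 0 < x \<and> x \<in> profile_dom n R}"
    obtain d where d: "0 < d" "d \<in> profile_dom n R"
      using profile_dom_open[OF order.refl zero_in_profile_dom[OF R]] by blast
    have K: "K > 0" using inb[OF d] d by (auto simp: in_box_def)
    \<comment> \<open>The larger box turns the closed bounds by \<open>K\<close> into the strict
      bounds needed for continuation, and it also contains the initial point.\<close>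
    define K' where "K' = max (max 1 K) (max R (1 / R)) + 1"
    have K': "K' \<ge> 1" "K < K'" "R < K'" "1 / R < K'" by (auto simp: K'_def)
    have K'': "1 / K' < R" "1 / K' < 1 / K" using K' K R by (simp_all add: divide_simps mult.commute)
    have bdd: "bdd_above D" unfolding D_def
      by (rule bdd_aboveI[of _ K]) (use inb in \<open>auto simp: in_box_def\<close>)
    define B where "B = Sup D"
    have B: "0 < B" using cSup_upper[OF _ bdd, of d] d unfolding B_def D_def by auto
    have dom: "x \<in> profile_dom n R" if "0 \<le> x" "x < B" for x
    proof -
      obtain y where "y \<in> D" "x < y"
        using \<open>x < B\<close> less_cSup_iff[OF _ bdd, of x] d unfolding B_def D_def by auto
      then show ?thesis using profile_dom_downward[of x y] that by (auto simp: D_def)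
    qed
    obtain U V where UV: "clipped_solution n K' R U V" using clipped_solution_exists[OF K'(1)] by blast
    obtain L where L: "\<And>x p q. norm (clipped_field n K' x p - clipped_field n K' x q) \<le> L * norm (p - q)"
      using clipped_field_lipschitz[OF K'(1)] by blast
    have inside: "in_box K x (U x) (V x)" if x: "0 < x" "x < B" for x
    proof -
      obtain a b u where u: "profile_solution n R a b u" "x < b"
        using dom[of x] x profile_dom_iff[of x] by auto
      have "in_box K' s (u s) (deriv u s)" if s: "0 \<le> s" "s \<le> x" for s
      proof (cases "s = 0")
        case True
        then show ?thesis using u K' K'' by (auto simp: profile_solution_def in_box_def)
      next
        case False
        then have "in_box K s (u s) (deriv u s)"
          using inb[of s] dom[of s] s x profile_eq[OF u(1), of s] deriv_profile_eq[OF u(1), of s] u by auto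
        then show ?thesis using K' K'' by (auto simp: in_box_def)
      qed
      then have "u x = U x" "deriv u x = V x"
        using profile_solution_near_clipped_solution[OF u _ UV L, of x] x by auto
      then show ?thesis
        using inb[of x] dom[of x] x profile_eq[OF u(1), of x] deriv_profile_eq[OF u(1), of x] u by auto
    qed
    \<comment> \<open>Closedness of the box carries the bounds from the open interval to its end
      point \<open>B\<close>.\<close>
    have cl: "closed {x. in_box K x (U x) (V x)}" unfolding in_box_def
      by (intro closed_Collect_conj closed_Collect_le continuous_intros
          clipped_solution_continuous[OF UV])
    have "{0<..<B} \<subseteq> {x. in_box K x (U x) (V x)}" using inside by auto
    from closure_minimal[OF this cl] have "{0..B} \<subseteq> {x. in_box K x (U x) (V x)}"
      using B by simp
    then have "in_box K B (U B) (V B)" using B by (metis atLeastAtMost_iff less_imp_le mem_Collect_eq order.refl subsetD)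
    then have "x < K' \<and> 1 / K' < U x \<and> U x < K' \<and> \<bar>V x\<bar> < K'" if "0 \<le> x" "x \<le> B" for x
      using that inside[of x] K' K'' UV
      by (cases "x = 0"; cases "x = B") (auto simp: in_box_def clipped_solution_def)
    from clipped_solution_imp_profile_solution[OF UV _ K'(1) this] B
    obtain a b where "B < b" "profile_solution n R a b U" by (metis less_imp_le)
    then have "B \<in> profile_dom n R" using B by (auto simp: profile_dom_iff)
    then obtain y where "B < y" "y \<in> profile_dom n R" using profile_dom_open[of B n R] B by auto
    then have "y \<in> D" using B by (simp add: D_def)
    then have "y \<le> B" unfolding B_def by (rule cSup_upper[OF _ bdd])
    then show False using \<open>B < y\<close> by simp
  qed
  then show thesis using that by blast
qed

text \<open>For \<open>S\<close> near \<open>R\<close>, Gronwall keeps the clipped solution starting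
  at height \<open>S\<close> so close to the curve of \<open>R\<close> on [0, x0] that it remains
  strictly inside the box, where it is the genuine profile of \<open>S\<close>.\<close>

lemma profile_stable:
  assumes x0: "0 < x0" "x0 \<in> profile_dom n R"
  shows "\<forall>\<^sub>F S in at R. x0 \<in> profile_dom n S"
    and "((\<lambda>S. profile n S x0) \<longlongrightarrow> profile n R x0) (at R)"
    and "((\<lambda>S. deriv (profile n S) x0) \<longlongrightarrow> deriv (profile n R) x0) (at R)"
proof -
  obtain a b u where u: "profile_solution n R a b u" "x0 < b"
    using x0 profile_dom_iff[of x0] by auto
  obtain m M where m: "m > 0"
    and M: "\<And>s. 0 \<le> s \<Longrightarrow> s \<le> x0 \<Longrightarrow> m \<le> u s \<and> u s \<le> M \<and> \<bar>deriv u s\<bar> \<le> M"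
    using profile_solution_bounds[OF u(1) _ u(2)] x0 by auto
  \<comment> \<open>This leaves room for a perturbation below min 1 (m / 2): heights stay above m /
    2 > 1 / K, heights and slopes below M + 1 \<le> K.\<close>
  define K where "K = Max {1, x0, M, 2 / m} + 1"
  have "1 \<le> Max {1, x0, M, 2 / m}" "x0 \<le> Max {1, x0, M, 2 / m}"
    "M \<le> Max {1, x0, M, 2 / m}" "2 / m \<le> Max {1, x0, M, 2 / m}"
    by (intro Max_ge; simp)+
  then have K: "1 \<le> K" "x0 < K" "M + 1 \<le> K" "2 / m < K" unfolding K_def by linarith+
  then have mK: "1 / K < m / 2" using m by (simp add: divide_simps mult.commute)
  have box: "in_box K s (u s) (deriv u s)" if "0 \<le> s" "s \<le> x0" for s
    using M[OF that] K mK that m by (auto simp: in_box_def)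
  obtain L where L: "\<And>x p q. norm (clipped_field n K x p - clipped_field n K x q) \<le> L * norm (p - q)"
    using clipped_field_lipschitz[OF K(1)] by blast
  define E where "E = exp (\<bar>L\<bar> * x0)"
  have key: "x0 \<in> profile_dom n S \<and> \<bar>profile n S x0 - profile n R x0\<bar> \<le> \<bar>R - S\<bar> * E
      \<and> \<bar>deriv (profile n S) x0 - deriv (profile n R) x0\<bar> \<le> \<bar>R - S\<bar> * E"
    if small: "\<bar>R - S\<bar> * E < min 1 (m / 2)" for S
  proof -
    obtain U V where UV: "clipped_solution n K S U V" using clipped_solution_exists[OF K(1)] by blast
    have close: "\<bar>u s - U s\<bar> \<le> \<bar>R - S\<bar> * E" "\<bar>deriv u s - V s\<bar> \<le> \<bar>R - S\<bar> * E"
      if s: "0 \<le> s" "s \<le> x0" for s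
    proof -
      have "L * s \<le> \<bar>L\<bar> * x0" using s by (meson abs_ge_self abs_ge_zero mult_mono order_trans)
      then have "\<bar>R - S\<bar> * exp (L * s) \<le> \<bar>R - S\<bar> * E" unfolding E_def
        by (intro mult_left_mono) auto
      with profile_solution_near_clipped_solution[OF u box UV L s]
      show "\<bar>u s - U s\<bar> \<le> \<bar>R - S\<bar> * E" "\<bar>deriv u s - V s\<bar> \<le> \<bar>R - S\<bar> * E" by auto
    qed
    have "s < K \<and> 1 / K < U s \<and> U s < K \<and> \<bar>V s\<bar> < K" if s: "0 \<le> s" "s \<le> x0" for s
      using close[OF s] M[OF s] K mK small s by auto
    from clipped_solution_imp_profile_solution[OF UV less_imp_le[OF x0(1)] K(1) this]
    obtain a' b' where S: "a' < 0" "x0 < b'" "profile_solution n S a' b' U"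
      "\<And>x. x \<in> {a'<..<b'} \<Longrightarrow> deriv U x = V x" by blast
    then have "x0 \<in> profile_dom n S" using x0 by (auto simp: profile_dom_iff)
    moreover have "profile n S x0 = U x0" "deriv (profile n S) x0 = V x0"
      using profile_eq[OF S(3), of x0] deriv_profile_eq[OF S(3), of x0] S x0 by auto
    moreover have "profile n R x0 = u x0" "deriv (profile n R) x0 = deriv u x0"
      using profile_eq[OF u(1), of x0] deriv_profile_eq[OF u(1), of x0] u x0 by auto
    ultimately show ?thesis using close[of x0] x0 by (simp add: abs_minus_commute)
  qed
  have lim: "((\<lambda>S. \<bar>R - S\<bar> * E) \<longlongrightarrow> 0) (at R)"
    by (auto intro!: tendsto_eq_intros)
  have ev: "\<forall>\<^sub>F S in at R. \<bar>R - S\<bar> * E < min 1 (m / 2)"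
    by (rule order_tendstoD(2)[OF lim]) (use m in auto)
  show "\<forall>\<^sub>F S in at R. x0 \<in> profile_dom n S"
    using ev by eventually_elim (use key in blast)
  have "((\<lambda>S. profile n S x0 - profile n R x0) \<longlongrightarrow> 0) (at R)"
    by (rule Lim_null_comparison[OF _ lim]) (use ev in eventually_elim, use key in auto)
  then show "((\<lambda>S. profile n S x0) \<longlongrightarrow> profile n R x0) (at R)"
    by (simp add: LIM_zero_iff)
  have "((\<lambda>S. deriv (profile n S) x0 - deriv (profile n R) x0) \<longlongrightarrow> 0) (at R)"
    by (rule Lim_null_comparison[OF _ lim]) (use ev in eventually_elim, use key in auto)
  then show "((\<lambda>S. deriv (profile n S) x0) \<longlongrightarrow> deriv (profile n R) x0) (at R)"
    by (simp add: LIM_zero_iff)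
qed

section \<open>Persistence of convexity and concavity\<close>

lemma DERIV_pos_imp_less:
  fixes f f' :: "real \<Rightarrow> real"
  assumes "x < y" "\<And>t. x \<le> t \<Longrightarrow> t \<le> y \<Longrightarrow> (f has_real_derivative f' t) (at t)"
    "\<And>t. x < t \<Longrightarrow> t < y \<Longrightarrow> f' t > 0"
  shows "f x < f y"
proof (rule DERIV_pos_imp_increasing_open[OF assms(1)])
  show "continuous_on {x..y} f"
    using assms(2) by (intro continuous_at_imp_continuous_on ballI) (auto intro: DERIV_isCont)
qed (use assms in \<open>metis less_imp_le\<close>)

lemma DERIV_neg_imp_greater:
  fixes f f' :: "real \<Rightarrow> real"
  assumes "x < y" "\<And>t. x \<le> t \<Longrightarrow> t \<le> y \<Longrightarrow> (f has_real_derivative f' t) (at t)"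
    "\<And>t. x < t \<Longrightarrow> t < y \<Longrightarrow> f' t < 0"
  shows "f y < f x"
  using DERIV_pos_imp_less[OF assms(1), of "\<lambda>t. - f t" "\<lambda>t. - f' t"] assms(2,3)
  by (auto intro!: derivative_intros)

text \<open>By continuity the infimum of the failure set is itself a failure, yet the bound holds
  everywhere before it, which \<open>step\<close> contradicts. So a sign condition at time t may be
  proved by assuming it at all earlier times.\<close>

lemma less_continuous_induct:
  fixes g :: "real \<Rightarrow> real"
  assumes cont: "continuous_on {0..x} g" and x: "0 \<le> x" and g0: "c < g 0"
    and step: "\<And>t. 0 < t \<Longrightarrow> t \<le> x \<Longrightarrow> (\<And>s. 0 \<le> s \<Longrightarrow> s < t \<Longrightarrow> c < g s) \<Longrightarrow> c < g t"
  shows "c < g x"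
proof (rule ccontr)
  assume "\<not> c < g x"
  define S where "S = {s \<in> {0..x}. g s \<le> c}"
  have S: "closed S" "S \<noteq> {}" "bdd_below S"
    unfolding S_def using continuous_closed_preimage[OF cont closed_atLeastAtMost closed_atMost, of c] \<open>\<not> c < g x\<close> x
    by (auto simp: vimage_def Int_def intro: bdd_belowI[of _ 0])
  have "Inf S \<in> S" using closed_contains_Inf[OF S(2,3,1)] .
  moreover have "c < g s" if "0 \<le> s" "s < Inf S" for s
    using cInf_lower[OF _ S(3), of s] that \<open>Inf S \<in> S\<close> by (force simp: S_def)
  ultimately show False
    using step[of "Inf S"] g0 by (cases "Inf S = 0") (auto simp: S_def)
qed

definition scaled_angle_rate :: "nat \<Rightarrow> real \<Rightarrow> real \<Rightarrow> real \<Rightarrow> real" where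
  "scaled_angle_rate n x u v = real n - 1 - u\<^sup>2 / 2 + x * u * v / 2"

lemma angle_rate_eq_scaled_angle_rate: "u > 0 \<Longrightarrow> angle_rate n x u v = scaled_angle_rate n x u v / u"
  by (simp add: angle_rate_def scaled_angle_rate_def field_simps power2_eq_square)

text \<open>\<open>k\<close> is given as an explicit expression in x, u, u' and g instead of as 2 *
  g' / W. Its derivative then involves u'' at most, which the equation provides, and no third
  derivative of u enters.\<close>

lemma scaled_angle_rate_derivs:
  assumes u: "(u has_real_derivative v x) (at x)" and pos: "u x > 0"
    and v: "(v has_real_derivative (1 + (v x)\<^sup>2) * angle_rate n x (u x) (v x)) (at x)"
  defines "W \<equiv> \<lambda>x. 1 + (v x)\<^sup>2" and "g \<equiv> \<lambda>x. scaled_angle_rate n x (u x) (v x)"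
  defines "k \<equiv> \<lambda>x. x * (1 - 1 / W x + g x) - u x * v x / W x"
  shows "(g has_real_derivative W x * k x / 2) (at x)"
    and "(k has_real_derivative x * W x / 2 * k x +
      2 * (v x * angle_rate n x (u x) (v x) * (x + u x * v x)) / W x) (at x)"
proof -
  define h where "h = angle_rate n x (u x) (v x)"
  have W: "W x \<noteq> 0" "W x > 0" unfolding W_def by (auto simp: add_nonneg_eq_0_iff intro: add_pos_nonneg)
  have gh: "g x = u x * h" using pos by (simp add: h_def angle_rate_eq_scaled_angle_rate g_def)
  have dv: "(v has_real_derivative W x * h) (at x)" using v by (simp add: W_def h_def)
  have dW: "(W has_real_derivative 2 * v x * (W x * h)) (at x)"
    unfolding W_def[abs_def] using dv by (auto intro!: derivative_eq_intros simp: W_def)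
  have "(g has_real_derivative (- u x * v x + x * (v x)\<^sup>2 + x * u x * (W x * h)) / 2) (at x)"
    unfolding g_def[abs_def] scaled_angle_rate_def using u dv
    by (auto intro!: derivative_eq_intros simp: field_simps power2_eq_square)
  moreover have "W x * k x = - u x * v x + x * (v x)\<^sup>2 + x * u x * (W x * h)"
    using W gh by (simp add: k_def field_simps) (simp add: W_def algebra_simps)
  ultimately show dg: "(g has_real_derivative W x * k x / 2) (at x)" by simp
  have "(k has_real_derivative (1 - 1 / W x + g x)
      + x * (2 * v x * (W x * h) / (W x)\<^sup>2 + W x * k x / 2)
      - ((v x * v x + u x * (W x * h)) * W x - u x * v x * (2 * v x * (W x * h))) / (W x)\<^sup>2) (at x)"
    unfolding k_def using u dv dW dg[unfolded k_def] W
    by (auto intro!: derivative_eq_intros simp: power2_eq_square)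
  \<comment> \<open>Pure algebra with y = u, z = u', m = k. The term 1 - 1 / w equals z^2 / w and
    cancels, y * h cancels as well, and the two terms left besides the one in m combine to the
    factor x + y * z.\<close>
  moreover have "(1 - 1 / w + y * h) + x * (2 * z * (w * h) / w\<^sup>2 + w * m / 2)
      - ((z * z + y * (w * h)) * w - y * z * (2 * z * (w * h))) / w\<^sup>2
    = x * w / 2 * m + 2 * (z * h * (x + y * z)) / w" if w: "w \<noteq> 0" "w = 1 + z * z" for w y z m
  proof -
    have "2 * z * (w * h) / w\<^sup>2 = 2 * z * h / w"
      using w(1) by (simp add: power2_eq_square)
    moreover have "((z * z + y * (w * h)) * w - y * z * (2 * z * (w * h))) / w\<^sup>2
        = z * z / w + y * h - 2 * (z * h * (y * z)) / w"
      using w(1) by (simp add: field_simps power2_eq_square)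
    moreover have "1 - 1 / w = z * z / w" using w by (simp add: diff_divide_eq_iff)
    ultimately show ?thesis
      by (simp add: distrib_left add_divide_distrib mult_ac)
  qed
  from this[OF W(1), of "v x" "u x" "k x"]
  have "(1 - 1 / W x + g x)
      + x * (2 * v x * (W x * h) / (W x)\<^sup>2 + W x * k x / 2)
      - ((v x * v x + u x * (W x * h)) * W x - u x * v x * (2 * v x * (W x * h))) / (W x)\<^sup>2
    = x * W x / 2 * k x + 2 * (v x * h * (x + u x * v x)) / W x"
    unfolding gh by (simp add: W_def power2_eq_square)
  ultimately show "(k has_real_derivative x * W x / 2 * k x +
      2 * (v x * angle_rate n x (u x) (v x) * (x + u x * v x)) / W x) (at x)"
    by (simp add: h_def)
qed

text \<open>The integrating factor exp (- M) reduces the linear equation for \<open>k\<close> to its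
  forcing term. Since \<open>k\<close> vanishes at 0, the sign of the forcing passes to
  \<open>k\<close> and then to the derivative of \<open>g\<close>. The factor \<open>s\<close> will
  be -1 above the sphere and 1 below the cylinder.\<close>

lemma scaled_angle_rate_strict_mono:
  assumes sol: "profile_solution n R a b u" and x: "0 < x" "x < b"
    and sign: "\<And>t. 0 < t \<Longrightarrow> t < x \<Longrightarrow>
      0 < s * (deriv u t * angle_rate n t (u t) (deriv u t) * (t + u t * deriv u t))"
  shows "s * (real n - 1 - R\<^sup>2 / 2) < s * scaled_angle_rate n x (u x) (deriv u x)"
proof -
  define v where "v = deriv u"
  define W where "W = (\<lambda>x. 1 + (v x)\<^sup>2)"
  define g where "g = (\<lambda>x. scaled_angle_rate n x (u x) (v x))"
  define k where "k = (\<lambda>x. x * (1 - 1 / W x + g x) - u x * v x / W x)"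
  define q where "q = (\<lambda>t. s * (v t * angle_rate n t (u t) (v t) * (t + u t * v t)))"
  have init: "a < 0" "0 < b" "u 0 = R" "v 0 = 0" using sol by (auto simp: profile_solution_def v_def)
  have d: "u t > 0" "(u has_real_derivative v t) (at t)"
    "(v has_real_derivative (1 + (v t)\<^sup>2) * angle_rate n t (u t) (v t)) (at t)" if "t \<in> {a<..<b}" for t
    using profile_solutionD[OF sol that] by (simp_all add: v_def)
  have W: "W t > 0" for t by (simp add: W_def add_pos_nonneg)
  have dg: "(g has_real_derivative W t * k t / 2) (at t)"
    and dk: "(k has_real_derivative t * W t / 2 * k t +
      2 * (v t * angle_rate n t (u t) (v t) * (t + u t * v t)) / W t) (at t)" if "t \<in> {a<..<b}" for t
    using scaled_angle_rate_derivs[OF d(2,1,3)[OF that]] by (simp_all add: W_def g_def k_def)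
  have "isCont (\<lambda>t. t * W t / 2) t" if "ereal a < ereal t" "ereal t < ereal b" for t
  proof -
    have "isCont v t" using d(3)[of t] that by (auto intro: DERIV_isCont)
    then show ?thesis unfolding W_def by (intro continuous_intros) auto
  qed
  then obtain M where "\<And>t. ereal a < ereal t \<Longrightarrow> ereal t < ereal b \<Longrightarrow>
      (M has_vector_derivative t * W t / 2) (at t)"
    using einterval_antiderivative[of a b "\<lambda>t. t * W t / 2"] init by auto
  then have M: "(M has_real_derivative t * W t / 2) (at t)" if "t \<in> {a<..<b}" for t
    using that by (auto simp: has_real_derivative_iff_has_vector_derivative)
  define E where "E = (\<lambda>t. s * k t * exp (- M t))"
  have dE: "(E has_real_derivative 2 * q t / W t * exp (- M t)) (at t)" if t: "t \<in> {a<..<b}" for t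
    unfolding E_def using W[of t]
    by (auto intro!: derivative_eq_intros dk[OF t] M[OF t] simp: q_def field_simps)
  have sk: "s * k t > 0" if t: "0 < t" "t \<le> x" for t
  proof -
    have "E 0 < E t"
    proof (rule DERIV_pos_imp_less[OF t(1) dE])
      fix r assume "0 < r" "r < t"
      then have "q r > 0" using sign[of r] t by (simp add: q_def v_def)
      then show "2 * q r / W r * exp (- M r) > 0" using W[of r] by simp
    qed (use init t x in auto)
    then show ?thesis by (simp add: E_def k_def init zero_less_mult_iff)
  qed
  have "s * g 0 < s * g x"
  proof (rule DERIV_pos_imp_less[OF x(1)])
    show "((\<lambda>t. s * g t) has_real_derivative s * (W t * k t / 2)) (at t)" if "0 \<le> t" "t \<le> x" for t
      by (intro DERIV_cmult dg) (use that init x in auto)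
    show "0 < s * (W t * k t / 2)" if "0 < t" "t < x" for t
      using mult_pos_pos[OF W[of t] sk[of t]] that by (simp add: mult_ac)
  qed
  then show ?thesis by (simp add: g_def init scaled_angle_rate_def v_def)
qed

lemma continuous_on_scaled_angle_rate:
  assumes "profile_solution n R a b u" "x < b"
  shows "continuous_on {0..x} (\<lambda>t. scaled_angle_rate n t (u t) (deriv u t))"
proof -
  have t: "t \<in> {a<..<b}" if "t \<in> {0..x}" for t
    using that assms by (auto simp: profile_solution_def)
  have "isCont u t" "isCont (deriv u) t" if "t \<in> {0..x}" for t
    using profile_solutionD(2,3)[OF assms(1) t[OF that]] by (auto intro: DERIV_isCont)
  then show ?thesis unfolding scaled_angle_rate_def
    by (intro continuous_at_imp_continuous_on ballI continuous_intros) auto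
qed

text \<open>The auxiliary facts \<open>v\<close> and \<open>phi\<close> assume g < -1 only before
  time \<open>t\<close>, so they can be used inside the continuous induction that proves this very
  bound; afterwards they give the other conclusions.\<close>

lemma profile_solution_outside_sphere:
  assumes sol: "profile_solution n R a b u" and R: "R\<^sup>2 > 2 * real n" and x: "0 < x" "x < b"
  shows "scaled_angle_rate n x (u x) (deriv u x) < - 1" "deriv u x < 0" "x + u x * deriv u x < 0" "u x < R"
proof -
  have init: "a < 0" "u 0 = R" "deriv u 0 = 0" using sol by (auto simp: profile_solution_def)
  note d = profile_solutionD[OF sol]
  have v: "deriv u t < 0" and phi: "t + u t * deriv u t < 0"
    if t: "0 < t" "t < b"
      and g: "\<And>s. 0 \<le> s \<Longrightarrow> s < t \<Longrightarrow> scaled_angle_rate n s (u s) (deriv u s) < - 1" for t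
  proof -
    have W: "1 + (deriv u s)\<^sup>2 > 0" for s by (simp add: add_pos_nonneg)
    have s: "s \<in> {a<..<b}" if "0 \<le> s" "s \<le> t" for s using that t init by auto
    have "deriv u t < deriv u 0"
    proof (rule DERIV_neg_imp_greater[OF t(1) d(3)[OF s]])
      fix r assume r: "0 < r" "r < t"
      then have "angle_rate n r (u r) (deriv u r) < 0"
        using g[of r] d(1)[OF s, of r] by (simp add: angle_rate_eq_scaled_angle_rate divide_less_0_iff)
      then show "(1 + (deriv u r)\<^sup>2) * angle_rate n r (u r) (deriv u r) < 0"
        using W[of r] by (simp add: mult_pos_neg)
    qed
    then show "deriv u t < 0" using init by simp
    have "t + u t * deriv u t < 0 + u 0 * deriv u 0"
    proof (rule DERIV_neg_imp_greater[OF t(1)])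
      show "((\<lambda>r. r + u r * deriv u r) has_real_derivative
          (1 + (deriv u r)\<^sup>2) * (1 + scaled_angle_rate n r (u r) (deriv u r))) (at r)"
        if r: "0 \<le> r" "r \<le> t" for r
        using d(1)[OF s[OF r]]
        by (auto intro!: derivative_eq_intros d(2,3)[OF s[OF r]]
            simp: angle_rate_eq_scaled_angle_rate field_simps power2_eq_square)
      show "(1 + (deriv u r)\<^sup>2) * (1 + scaled_angle_rate n r (u r) (deriv u r)) < 0" if "0 < r" "r < t" for r
        using g[of r] that W[of r] by (simp add: mult_pos_neg)
    qed
    then show "t + u t * deriv u t < 0" using init by simp
  qed
  have g: "scaled_angle_rate n y (u y) (deriv u y) < - 1" if y: "0 \<le> y" "y < b" for y
  proof -
    have "1 < - scaled_angle_rate n y (u y) (deriv u y)"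
    proof (rule less_continuous_induct[where x = y])
      show "continuous_on {0..y} (\<lambda>y. - scaled_angle_rate n y (u y) (deriv u y))"
        by (intro continuous_on_minus continuous_on_scaled_angle_rate[OF sol y(2)])
      show "1 < - scaled_angle_rate n 0 (u 0) (deriv u 0)" using R init by (simp add: scaled_angle_rate_def)
      fix t assume t: "0 < t" "t \<le> y"
        and less: "\<And>s. 0 \<le> s \<Longrightarrow> s < t \<Longrightarrow> 1 < - scaled_angle_rate n s (u s) (deriv u s)"
      \<comment> \<open>Before \<open>t\<close> all of u', h and \<phi> are negative, hence so is
        their product. With \<open>s = -1\<close> this keeps g below its initial value, which is
        below -1.\<close>
      have "(- 1) * (real n - 1 - R\<^sup>2 / 2) < (- 1) * scaled_angle_rate n t (u t) (deriv u t)"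
      proof (rule scaled_angle_rate_strict_mono[OF sol t(1)])
        fix r assume r: "0 < r" "r < t"
        have gr: "scaled_angle_rate n s (u s) (deriv u s) < - 1" if "0 \<le> s" "s < r" for s
          using less[of s] that r by simp
        have "u r > 0" using r t y init by (intro d(1)) auto
        then have "angle_rate n r (u r) (deriv u r) < 0"
          using less[of r] r by (simp add: angle_rate_eq_scaled_angle_rate divide_less_0_iff)
        moreover have "deriv u r < 0" "r + u r * deriv u r < 0"
          using v[OF _ _ gr] phi[OF _ _ gr] r t y by auto
        ultimately show "0 < (- 1) * (deriv u r * angle_rate n r (u r) (deriv u r) * (r + u r * deriv u r))"
          by (simp add: mult_neg_neg mult_pos_neg)
      qed (use t y in auto)
      then show "1 < - scaled_angle_rate n t (u t) (deriv u t)" using R by simp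
    qed (use y in auto)
    then show ?thesis by simp
  qed
  show "scaled_angle_rate n x (u x) (deriv u x) < - 1" using g x by simp
  show "deriv u x < 0" "x + u x * deriv u x < 0" using v[of x] phi[of x] g x by auto
  have "u x < u 0"
  proof (rule DERIV_neg_imp_greater[OF x(1) d(2)])
    show "deriv u t < 0" if "0 < t" "t < x" for t using v[of t] g that x by auto
  qed (use init x in auto)
  then show "u x < R" using init by simp
qed

text \<open>Here x + u * u' is positive as soon as u' is, so only the sign of g has to be
  propagated. The bound by the initial value of g, stronger than positivity, later controls the rate
  of turning.\<close>

lemma profile_solution_inside_cylinder:
  assumes sol: "profile_solution n R a b u" and R: "R\<^sup>2 < 2 * (real n - 1)" and x: "0 < x" "x < b"
  shows "scaled_angle_rate n x (u x) (deriv u x) > real n - 1 - R\<^sup>2 / 2" "deriv u x > 0" "u x > R"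
proof -
  have init: "a < 0" "u 0 = R" "deriv u 0 = 0" using sol by (auto simp: profile_solution_def)
  note d = profile_solutionD[OF sol]
  have v: "deriv u t > 0" if t: "0 < t" "t < b"
      and g: "\<And>s. 0 \<le> s \<Longrightarrow> s < t \<Longrightarrow> 0 < scaled_angle_rate n s (u s) (deriv u s)" for t
  proof -
    have s: "s \<in> {a<..<b}" if "0 \<le> s" "s \<le> t" for s using that t init by auto
    have "deriv u 0 < deriv u t"
    proof (rule DERIV_pos_imp_less[OF t(1) d(3)[OF s]])
      fix r assume r: "0 < r" "r < t"
      then have "angle_rate n r (u r) (deriv u r) > 0"
        using g[of r] d(1)[OF s, of r] by (simp add: angle_rate_eq_scaled_angle_rate)
      then show "(1 + (deriv u r)\<^sup>2) * angle_rate n r (u r) (deriv u r) > 0"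
        by (intro mult_pos_pos add_pos_nonneg) auto
    qed
    then show "deriv u t > 0" using init by simp
  qed
  have mono: "real n - 1 - R\<^sup>2 / 2 < scaled_angle_rate n t (u t) (deriv u t)"
    if t: "0 < t" "t < b"
      and g: "\<And>s. 0 \<le> s \<Longrightarrow> s < t \<Longrightarrow> 0 < scaled_angle_rate n s (u s) (deriv u s)" for t
  proof -
    have "1 * (real n - 1 - R\<^sup>2 / 2) < 1 * scaled_angle_rate n t (u t) (deriv u t)"
    proof (rule scaled_angle_rate_strict_mono[OF sol t])
      fix r assume r: "0 < r" "r < t"
      have ur: "u r > 0" using r t init by (intro d(1)) auto
      then have "angle_rate n r (u r) (deriv u r) > 0"
        using g[of r] r by (simp add: angle_rate_eq_scaled_angle_rate)
      moreover have "deriv u r > 0" using v[of r] g r t by auto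
      ultimately show "0 < 1 * (deriv u r * angle_rate n r (u r) (deriv u r) * (r + u r * deriv u r))"
        using ur r by (simp add: add_pos_pos)
    qed
    then show ?thesis by simp
  qed
  have g: "0 < scaled_angle_rate n y (u y) (deriv u y)" if y: "0 \<le> y" "y < b" for y
  proof (rule less_continuous_induct[where x = y])
    show "continuous_on {0..y} (\<lambda>y. scaled_angle_rate n y (u y) (deriv u y))"
      by (rule continuous_on_scaled_angle_rate[OF sol y(2)])
    show "0 < scaled_angle_rate n 0 (u 0) (deriv u 0)" using R init by (simp add: scaled_angle_rate_def)
    fix t assume t: "0 < t" "t \<le> y"
      and "\<And>s. 0 \<le> s \<Longrightarrow> s < t \<Longrightarrow> 0 < scaled_angle_rate n s (u s) (deriv u s)"
    then have "real n - 1 - R\<^sup>2 / 2 < scaled_angle_rate n t (u t) (deriv u t)" using mono[of t] y by auto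
    then show "0 < scaled_angle_rate n t (u t) (deriv u t)" using R by simp
  qed (use y in auto)
  show "scaled_angle_rate n x (u x) (deriv u x) > real n - 1 - R\<^sup>2 / 2" using mono[of x] g x by auto
  show "deriv u x > 0" using v[of x] g x by auto
  have "u 0 < u x"
  proof (rule DERIV_pos_imp_less[OF x(1) d(2)])
    show "deriv u t > 0" if "0 < t" "t < x" for t using v[of t] g that x by auto
  qed (use init x in auto)
  then show "u x > R" using init by simp
qed

section \<open>Vertical points\<close>

abbreviation (input) dprofile :: "nat \<Rightarrow> real \<Rightarrow> real \<Rightarrow> real" where
  "dprofile n R \<equiv> deriv (profile n R)"

lemma arctan_dprofile_deriv:
  assumes "0 < x" "x \<in> profile_dom n R"
  shows "((\<lambda>x. arctan (dprofile n R x)) has_real_derivative angle_rate n x (profile n R x) (dprofile n R x)) (at x)"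
proof -
  have "1 + (dprofile n R x)\<^sup>2 \<noteq> 0" by (simp add: add_nonneg_eq_0_iff)
  then show ?thesis
    using DERIV_chain2[OF DERIV_arctan profile_derivs(3)[OF assms]]
    by (simp only: mult.assoc[symmetric] left_inverse mult_1_left not_False_eq_True)
qed

lemma arctan_less_pi_half: "\<bar>arctan x\<bar> < pi / 2"
  using arctan_bounded[of x] by linarith

lemma profile_dom_between:
  "0 < x \<Longrightarrow> x \<le> t \<Longrightarrow> t \<le> y \<Longrightarrow> y \<in> profile_dom n R \<Longrightarrow> 0 < t \<and> t \<in> profile_dom n R"
  using profile_dom_downward[of t y n R] by auto

lemma profile_leaves_bounds:
  assumes "R > 0" "m > 0"
  obtains x where "0 < x" "x \<in> profile_dom n R"
    "M < x \<or> profile n R x < m \<or> M < profile n R x \<or> M < \<bar>dprofile n R x\<bar>"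
proof -
  define K where "K = max M (1 / m)"
  have K: "1 / m \<le> K" "M \<le> K" by (auto simp: K_def)
  moreover from K have "K > 0" using assms(2) less_le_trans[of 0 "1 / m" K] by simp
  ultimately have "1 / K \<le> m" "M \<le> K" using assms(2) by (auto simp: divide_simps mult.commute)
  moreover obtain x where "0 < x" "x \<in> profile_dom n R"
    "\<not> in_box K x (profile n R x) (dprofile n R x)"
    using profile_leaves_box[OF assms(1)] by blast
  ultimately show thesis using that[of x] by (fastforce simp: in_box_def)
qed

text \<open>The candidate for b_R. The supremum is informative only once the domain is known to be
  bounded, which is shown separately above the sphere and below the cylinder.\<close>

definition profile_sup :: "nat \<Rightarrow> real \<Rightarrow> real" where
  "profile_sup n R = Sup {x. 0 < x \<and> x \<in> profile_dom n R}"

lemma profile_sup: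
  assumes R: "R > 0" and C: "\<And>x. 0 < x \<Longrightarrow> x \<in> profile_dom n R \<Longrightarrow> x \<le> C"
  shows "0 < profile_sup n R" "0 \<le> x \<Longrightarrow> x \<in> profile_dom n R \<longleftrightarrow> x < profile_sup n R"
proof -
  let ?D = "{x. 0 < x \<and> x \<in> profile_dom n R}"
  have bdd: "bdd_above ?D" using C by (intro bdd_aboveI[of _ C]) auto
  obtain d where d: "0 < d" "d \<in> profile_dom n R"
    using profile_dom_open[OF order.refl zero_in_profile_dom[OF R]] by blast
  have le: "y \<le> profile_sup n R" if "y \<in> ?D" for y
    unfolding profile_sup_def by (rule cSup_upper[OF that bdd])
  show "0 < profile_sup n R" using le[of d] d by auto
  show "x \<in> profile_dom n R \<longleftrightarrow> x < profile_sup n R" if x: "0 \<le> x"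
  proof
    assume "x \<in> profile_dom n R"
    then obtain y where "x < y" "y \<in> profile_dom n R" using profile_dom_open[OF x] by blast
    then show "x < profile_sup n R" using le[of y] x by auto
  next
    assume "x < profile_sup n R"
    then obtain y where "y \<in> ?D" "x < y"
      using d unfolding profile_sup_def by (subst (asm) less_cSup_iff[OF _ bdd]) auto
    then show "x \<in> profile_dom n R" using profile_dom_downward[of x y] x by auto
  qed
qed

lemma mono_tendsto_at_left:
  fixes f :: "real \<Rightarrow> real"
  assumes "0 < B" "\<And>x y. 0 < x \<Longrightarrow> x \<le> y \<Longrightarrow> y < B \<Longrightarrow> f x \<le> f y" "\<And>x. 0 < x \<Longrightarrow> x < B \<Longrightarrow> f x \<le> M"
  shows "\<exists>l. (f \<longlongrightarrow> l) (at_left B)"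
proof -
  have "(f \<longlongrightarrow> Sup (f ` ({..<B} \<inter> {0<..}))) (at B within ({..<B} \<inter> {0<..}))"
    by (rule Lim_left_bound) (use assms in auto)
  moreover have "at B within ({..<B} \<inter> {0<..}) = at_left B"
    by (rule at_within_nhd[of _ "{0<..}"]) (use assms(1) in auto)
  ultimately show ?thesis by metis
qed

lemma mono_unbounded_at_left:
  fixes f :: "real \<Rightarrow> real"
  assumes "\<And>x y. 0 < x \<Longrightarrow> x \<le> y \<Longrightarrow> y < B \<Longrightarrow> f x \<le> f y" "\<And>Z. \<exists>x. 0 < x \<and> x < B \<and> Z \<le> f x"
  shows "filterlim f at_top (at_left B)"
  unfolding filterlim_at_top
proof
  fix Z
  obtain x where x: "0 < x" "x < B" "Z \<le> f x" using assms(2) by blast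
  show "\<forall>\<^sub>F x in at_left B. Z \<le> f x"
    using eventually_at_left_real[OF x(2)]
  proof eventually_elim
    case (elim y)
    then show ?case using assms(1)[of x y] x by auto
  qed
qed

text \<open>Past a point where the slope is steep, the curve is within \<open>C * (pi / 2 - arctan \<bar>u'\<bar>)\<close> of
  its vertical point; if \<open>C\<close> serves all nearby curves, then the vertical point is continuous.\<close>

lemma isCont_vertical_point:
  fixes b r :: "real \<Rightarrow> real"
  assumes b: "0 < b R" and dom: "\<And>x. 0 < x \<Longrightarrow> x < b R \<Longrightarrow> x \<in> profile_dom n R"
    and r: "(profile n R \<longlongrightarrow> r R) (at_left (b R))"
    and V: "filterlim (\<lambda>x. \<bar>dprofile n R x\<bar>) at_top (at_left (b R))"
    and z: "z < b R"
    and tail: "\<forall>\<^sub>F S in at R. \<forall>x. 0 < x \<longrightarrow> x \<in> profile_dom n S \<longrightarrow> z < x \<longrightarrow> c < \<bar>dprofile n S x\<bar> \<longrightarrow>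
      \<bar>b S - x\<bar> \<le> C * (pi / 2 - arctan \<bar>dprofile n S x\<bar>) \<and>
      \<bar>r S - profile n S x\<bar> \<le> C * (pi / 2 - arctan \<bar>dprofile n S x\<bar>)"
  shows "isCont (\<lambda>S. (b S, r S)) R"
proof -
  \<comment> \<open>The order of choices matters: first a point x close to \<open>b R\<close>,
    depending only on \<open>R\<close> and \<open>e\<close>, then \<open>S\<close> close to
    \<open>R\<close> with x fixed. The thirds of \<open>e\<close> pay for the tail of the curve of
    \<open>S\<close>, the change of the curve at x, and the tail of the curve of
    \<open>R\<close>.\<close>
  have near: "\<forall>\<^sub>F S in at R. \<bar>b S - b R\<bar> < e \<and> \<bar>r S - r R\<bar> < e" if e: "e > 0" for e
  proof -
    define \<delta> where "\<delta> v = C * (pi / 2 - arctan \<bar>v\<bar>)" for v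
    have "((\<lambda>x. C * (pi / 2 - arctan \<bar>dprofile n R x\<bar>)) \<longlongrightarrow> C * (pi / 2 - pi / 2)) (at_left (b R))"
      by (intro tendsto_intros filterlim_compose[OF tendsto_arctan_at_top V])
    then have "\<forall>\<^sub>F x in at_left (b R). \<delta> (dprofile n R x) < e / 3"
      using e by (intro order_tendstoD(2)) (auto simp: \<delta>_def)
    moreover have "\<forall>\<^sub>F x in at_left (b R). dist (profile n R x) (r R) < e / 3"
      using e by (intro tendstoD[OF r]) simp
    moreover have "\<forall>\<^sub>F x in at_left (b R). c < \<bar>dprofile n R x\<bar>"
      using V by (simp add: filterlim_at_top_dense)
    moreover have "\<forall>\<^sub>F x in at_left (b R). x \<in> {max (max 0 z) (b R - e / 3)<..<b R}"
      by (rule eventually_at_left_real) (use b z e in auto)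
    ultimately have "\<forall>\<^sub>F x in at_left (b R). \<delta> (dprofile n R x) < e / 3 \<and>
        dist (profile n R x) (r R) < e / 3 \<and> c < \<bar>dprofile n R x\<bar> \<and>
        x \<in> {max (max 0 z) (b R - e / 3)<..<b R}"
      by eventually_elim auto
    then obtain x where x: "\<delta> (dprofile n R x) < e / 3" "dist (profile n R x) (r R) < e / 3"
      "c < \<bar>dprofile n R x\<bar>" "0 < x" "z < x" "x < b R" "b R - e / 3 < x"
      using eventually_happens'[OF trivial_limit_at_left_real] by fastforce
    note st = profile_stable[OF x(4) dom[OF x(4,6)]]
    have "((\<lambda>S. \<delta> (dprofile n S x)) \<longlongrightarrow> \<delta> (dprofile n R x)) (at R)"
      unfolding \<delta>_def by (intro tendsto_intros st(3))
    then have "\<forall>\<^sub>F S in at R. \<delta> (dprofile n S x) < e / 3"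
      using x(1) by (rule order_tendstoD(2))
    moreover have "\<forall>\<^sub>F S in at R. dist (profile n S x) (profile n R x) < e / 3"
      using e by (intro tendstoD[OF st(2)]) simp
    moreover have "((\<lambda>S. \<bar>dprofile n S x\<bar>) \<longlongrightarrow> \<bar>dprofile n R x\<bar>) (at R)"
      by (intro tendsto_intros st(3))
    then have "\<forall>\<^sub>F S in at R. c < \<bar>dprofile n S x\<bar>"
      using x(3) by (rule order_tendstoD(1))
    ultimately show ?thesis using tail st(1)
    proof eventually_elim
      case (elim S)
      then have "\<bar>b S - x\<bar> \<le> \<delta> (dprofile n S x) \<and> \<bar>r S - profile n S x\<bar> \<le> \<delta> (dprofile n S x)"
        using x(4,5) unfolding \<delta>_def by blast
      then have "\<bar>b S - x\<bar> < e / 3" "\<bar>r S - profile n S x\<bar> < e / 3"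
        using elim(1) by linarith+
      then show ?case using elim(2) x(2,6,7) unfolding dist_real_def by linarith
    qed
  qed
  have "(b \<longlongrightarrow> b R) (at R)" "(r \<longlongrightarrow> r R) (at R)"
    unfolding tendsto_iff dist_real_def by (blast intro: eventually_mono[OF near])+
  then show ?thesis by (auto simp: isCont_def intro: tendsto_Pair)
qed

text \<open>The last conclusion is h = g / u < -1 / u < -1 / R, a definite rate at which the tangent
  turns downwards.\<close>

lemma profile_outside_sphere:
  assumes R: "R > sqrt (2 * real n)" and x: "0 < x" "x \<in> profile_dom n R"
  shows "scaled_angle_rate n x (profile n R x) (dprofile n R x) < - 1" "dprofile n R x < 0"
    "x + profile n R x * dprofile n R x < 0" "profile n R x < R" "profile n R x > 0"
    "angle_rate n x (profile n R x) (dprofile n R x) < - 1 / R"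
proof -
  have R2: "R\<^sup>2 > 2 * real n" using power_strict_mono[OF R, of 2] by simp
  obtain a b u where u: "profile_solution n R a b u" "x < b"
    using x profile_dom_iff[of x] by auto
  have eq: "profile n R x = u x" "dprofile n R x = deriv u x"
    using profile_eq[OF u(1)] deriv_profile_eq[OF u(1)] u x by auto
  show g: "scaled_angle_rate n x (profile n R x) (dprofile n R x) < - 1" and "dprofile n R x < 0"
    "x + profile n R x * dprofile n R x < 0" and uR: "profile n R x < R"
    unfolding eq by (rule profile_solution_outside_sphere[OF u(1) R2 x(1) u(2)])+
  show pos: "profile n R x > 0" by (rule profile_derivs(1)[OF x])
  have "scaled_angle_rate n x (profile n R x) (dprofile n R x) / profile n R x < - 1 / profile n R x"
    using g pos by (intro divide_strict_right_mono)
  also have "\<dots> < - 1 / R" using pos uR by (simp add: frac_less2)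
  finally show "angle_rate n x (profile n R x) (dprofile n R x) < - 1 / R"
    by (simp add: angle_rate_eq_scaled_angle_rate pos)
qed

lemma profile_inside_cylinder:
  assumes R: "0 < R" "R\<^sup>2 < 2 * (real n - 1)" and x: "0 < x" "x \<in> profile_dom n R"
  shows "dprofile n R x > 0" "profile n R x > R"
    "angle_rate n x (profile n R x) (dprofile n R x) > (real n - 1 - R\<^sup>2 / 2) / profile n R x"
    "angle_rate n x (profile n R x) (dprofile n R x) > 0"
proof -
  obtain a b u where u: "profile_solution n R a b u" "x < b"
    using x profile_dom_iff[of x] by auto
  have eq: "profile n R x = u x" "dprofile n R x = deriv u x"
    using profile_eq[OF u(1)] deriv_profile_eq[OF u(1)] u x by auto
  have g: "scaled_angle_rate n x (profile n R x) (dprofile n R x) > real n - 1 - R\<^sup>2 / 2"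
    unfolding eq by (rule profile_solution_inside_cylinder[OF u(1) R(2) x(1) u(2)])
  show "dprofile n R x > 0" "profile n R x > R"
    unfolding eq by (rule profile_solution_inside_cylinder[OF u(1) R(2) x(1) u(2)])+
  have pos: "profile n R x > 0" by (rule profile_derivs(1)[OF x])
  show "angle_rate n x (profile n R x) (dprofile n R x) > (real n - 1 - R\<^sup>2 / 2) / profile n R x"
    unfolding angle_rate_eq_scaled_angle_rate[OF pos] using g pos by (rule divide_strict_right_mono)
  show "angle_rate n x (profile n R x) (dprofile n R x) > 0"
    using g pos R by (simp add: angle_rate_eq_scaled_angle_rate)
qed

section \<open>Initial heights above the sphere: concave branches\<close>

context
  fixes n :: nat and R :: real
  assumes R: "R > sqrt (2 * real n)"
begin

lemma sphere_radius_pos: "R > 0"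
  using R real_sqrt_ge_zero[of "2 * real n"] by linarith

lemma dprofile_decreasing:
  assumes "0 < x" "x < y" "y \<in> profile_dom n R"
  shows "dprofile n R y < dprofile n R x"
proof (rule DERIV_neg_imp_greater[OF assms(2)])
  fix t assume "x \<le> t" "t \<le> y"
  then have t: "0 < t" "t \<in> profile_dom n R" using profile_dom_between[OF assms(1) _ _ assms(3)] by auto
  show "(dprofile n R has_real_derivative (1 + (dprofile n R t)\<^sup>2) *
      angle_rate n t (profile n R t) (dprofile n R t)) (at t)"
    by (rule profile_derivs(3)[OF t])
next
  fix t assume "x < t" "t < y"
  then have t: "0 < t" "t \<in> profile_dom n R" using profile_dom_between[OF assms(1) _ _ assms(3), of t] by auto
  have "angle_rate n t (profile n R t) (dprofile n R t) < - 1 / R" using profile_outside_sphere(6)[OF R t] .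
  also have "\<dots> < 0" using sphere_radius_pos by simp
  finally show "(1 + (dprofile n R t)\<^sup>2) * angle_rate n t (profile n R t) (dprofile n R t) < 0"
    by (intro mult_pos_neg add_pos_nonneg) auto
qed

lemma profile_decreasing:
  assumes "0 < x" "x < y" "y \<in> profile_dom n R"
  shows "profile n R y < profile n R x"
  by (rule DERIV_neg_imp_greater[OF assms(2), of _ "dprofile n R"])
    (use profile_dom_between[OF assms(1) _ _ assms(3)] profile_derivs(2) profile_outside_sphere(2)[OF R] in auto)

text \<open>arctan u' + x / R decreases along the curve, and from x on the tangent can turn by less
  than pi / 2 - arctan |u'(x)|.\<close>

lemma concave_length_bound:
  assumes "0 < x" "x < y" "y \<in> profile_dom n R"
  shows "y - x < R * (pi / 2 - arctan \<bar>dprofile n R x\<bar>)"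
proof -
  have "arctan (dprofile n R y) + y / R < arctan (dprofile n R x) + x / R"
  proof (rule DERIV_neg_imp_greater[OF assms(2)])
    fix t assume "x \<le> t" "t \<le> y"
    then have t: "0 < t" "t \<in> profile_dom n R" using profile_dom_between[OF assms(1) _ _ assms(3)] by auto
    show "((\<lambda>t. arctan (dprofile n R t) + t / R) has_real_derivative
        angle_rate n t (profile n R t) (dprofile n R t) + 1 / R) (at t)"
      by (rule DERIV_cong[OF DERIV_add[OF arctan_dprofile_deriv[OF t] DERIV_cdivide[OF DERIV_ident]]]) simp
  next
    fix t assume "x < t" "t < y"
    then have t: "0 < t" "t \<in> profile_dom n R" using profile_dom_between[OF assms(1) _ _ assms(3), of t] by auto
    show "angle_rate n t (profile n R t) (dprofile n R t) + 1 / R < 0"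
      using profile_outside_sphere(6)[OF R t] by simp
  qed
  moreover have x: "x \<in> profile_dom n R" using profile_dom_between[OF assms(1) _ _ assms(3), of x] assms by auto
  moreover have "\<bar>dprofile n R x\<bar> = - dprofile n R x" using profile_outside_sphere(2)[OF R assms(1) x] by simp
  ultimately have "(y - x) / R < pi / 2 - arctan \<bar>dprofile n R x\<bar>"
    using arctan_less_pi_half[of "dprofile n R y"] by (simp add: arctan_minus diff_divide_distrib)
  then show ?thesis using sphere_radius_pos by (simp add: divide_simps mult.commute)
qed

text \<open>The turning is measured per unit of height. Beyond x the term t / 2 * u' is at most x /
  2 * u'; \<open>steep\<close> is calibrated so that half of this absorbs (n - 1) / u \<le> (n - 1)
  / e, and the other half makes arctan u' - x / 4 * u decrease.\<close>

lemma concave_height_bound: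
  assumes "0 < x" "x < y" "y \<in> profile_dom n R" and n: "n \<ge> 1" and e: "e > 0" "e \<le> profile n R y"
    and steep: "4 * (real n - 1) / (e * x) \<le> \<bar>dprofile n R x\<bar>"
  shows "profile n R x - profile n R y \<le> 4 / x * (pi / 2 - arctan \<bar>dprofile n R x\<bar>)"
proof -
  have x: "x \<in> profile_dom n R" using profile_dom_between[OF assms(1) _ _ assms(3), of x] assms by auto
  have v: "\<bar>dprofile n R x\<bar> = - dprofile n R x" using profile_outside_sphere(2)[OF R assms(1) x] by simp
  have "arctan (dprofile n R y) - x / 4 * profile n R y < arctan (dprofile n R x) - x / 4 * profile n R x"
  proof (rule DERIV_neg_imp_greater[OF assms(2)])
    fix t assume "x \<le> t" "t \<le> y"
    then have t: "0 < t" "t \<in> profile_dom n R" using profile_dom_between[OF assms(1) _ _ assms(3)] by auto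
    show "((\<lambda>t. arctan (dprofile n R t) - x / 4 * profile n R t) has_real_derivative
        angle_rate n t (profile n R t) (dprofile n R t) - x / 4 * dprofile n R t) (at t)"
      by (intro DERIV_diff DERIV_cmult arctan_dprofile_deriv[OF t] profile_derivs(2)[OF t])
  next
    fix t assume xt: "x < t" "t < y"
    then have t: "0 < t" "t \<in> profile_dom n R" using profile_dom_between[OF assms(1) _ _ assms(3), of t] by auto
    let ?u = "profile n R t" and ?v = "dprofile n R t"
    have u: "e < ?u" using profile_decreasing[OF t(1) xt(2) assms(3)] e by simp
    have "?v < dprofile n R x" using dprofile_decreasing[OF assms(1) xt(1) t(2)] .
    then have v': "?v < - (4 * (real n - 1) / (e * x))" using steep v by simp
    have "(real n - 1) / ?u \<le> (real n - 1) / e" using u e n by (intro divide_left_mono) auto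
    moreover have "(real n - 1) / e < x / 4 * (- ?v)"
    proof -
      have "(real n - 1) / e = x / 4 * (4 * (real n - 1) / (e * x))" using e assms(1) by (simp add: field_simps)
      also have "\<dots> < x / 4 * (- ?v)" using v' assms(1) by (intro mult_strict_left_mono) auto
      finally show ?thesis .
    qed
    moreover have "t / 2 * ?v \<le> x / 2 * ?v"
      using xt profile_outside_sphere(2)[OF R t] by (intro mult_right_mono_neg) auto
    moreover have "angle_rate n t ?u ?v = (real n - 1) / ?u - ?u / 2 + t / 2 * ?v" by (simp add: angle_rate_def)
    ultimately show "angle_rate n t ?u ?v - x / 4 * ?v < 0" using u e by linarith
  qed
  then have "x / 4 * (profile n R x - profile n R y) < pi / 2 - arctan \<bar>dprofile n R x\<bar>"
    using arctan_less_pi_half[of "dprofile n R y"] v by (simp add: arctan_minus algebra_simps)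
  then show ?thesis using assms(1) by (simp add: divide_simps mult.commute)
qed

lemma concave_profile_sup:
  shows "0 < profile_sup n R" "0 \<le> x \<Longrightarrow> x \<in> profile_dom n R \<longleftrightarrow> x < profile_sup n R"
proof -
  obtain d where d: "0 < d" "d \<in> profile_dom n R"
    using profile_dom_open[OF order.refl zero_in_profile_dom[OF sphere_radius_pos]] by blast
  have C: "x \<le> d + R * (pi / 2 - arctan \<bar>dprofile n R d\<bar>)" if x: "0 < x" "x \<in> profile_dom n R" for x
  proof (cases "d < x")
    case True
    then show ?thesis using concave_length_bound[OF d(1) True x(2)] by simp
  next
    case False
    then show ?thesis
      using sphere_radius_pos arctan_less_pi_half[of "\<bar>dprofile n R d\<bar>"]
        mult_nonneg_nonneg[of R "pi / 2 - arctan \<bar>dprofile n R d\<bar>"] by linarith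
  qed
  show "0 < profile_sup n R" "0 \<le> x \<Longrightarrow> x \<in> profile_dom n R \<longleftrightarrow> x < profile_sup n R"
    by (rule profile_sup[OF sphere_radius_pos C]; assumption)+
qed

text \<open>With domain and height bounded, the curve can leave every box only through unbounded
  slope or heights tending to 0. The latter entails the former, because x + u * u' < 0 means |u'| >
  x / u.\<close>

lemma concave_vertical:
  "filterlim (dprofile n R) at_bot (at_left (profile_sup n R))"
proof -
  let ?B = "profile_sup n R"
  note B = concave_profile_sup
  have "filterlim (\<lambda>x. - dprofile n R x) at_top (at_left ?B)"
  proof (rule mono_unbounded_at_left)
    fix x y assume "0 < x" "x \<le> y" "y < ?B"
    then show "- dprofile n R x \<le> - dprofile n R y"
      using dprofile_decreasing[of x y] B(2)[of y] by (cases "x = y") auto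
  next
    fix Z
    show "\<exists>x. 0 < x \<and> x < ?B \<and> Z \<le> - dprofile n R x"
    proof (rule ccontr)
      assume no: "\<not> ?thesis"
      define c where "c = max Z 1"
      \<comment> \<open>Heights below \<open>m\<close> are impossible in either half of the domain:
        by the first entry and monotonicity for x \<le> B / 2, and by the second for x > B / 2,
        where a slope bounded by \<open>c\<close> forces u > B / (2 * c).\<close>
      define m where "m = min (profile n R (?B / 2)) (?B / (2 * c))"
      have "0 < profile n R (?B / 2)"
        using B(1) B(2)[of "?B / 2"] by (intro profile_derivs(1)) auto
      then have m: "m > 0" using B(1) by (auto simp: m_def c_def)
      obtain x where x: "0 < x" "x \<in> profile_dom n R"
        and out: "max (max ?B R) c < x \<or> profile n R x < m \<or> max (max ?B R) c < profile n R x
          \<or> max (max ?B R) c < \<bar>dprofile n R x\<bar>"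
        using profile_leaves_bounds[OF sphere_radius_pos m] by blast
      note o = profile_outside_sphere[OF R x]
      have xB: "x < ?B" using B(2)[of x] x by simp
      have v: "- dprofile n R x < c" using no x xB by (auto simp: c_def)
      then have lt: "profile n R x < m" using out xB o by auto
      show False
      proof (cases "x \<le> ?B / 2")
        case True
        then have "profile n R (?B / 2) \<le> profile n R x"
          using profile_decreasing[of x "?B / 2"] x B(1) B(2)[of "?B / 2"] by (cases "?B / 2 = x") auto
        then show False using lt by (simp add: m_def)
      next
        case False
        have "x < profile n R x * (- dprofile n R x)" using o(3) by simp
        also have "\<dots> \<le> profile n R x * c" using v o(5) by (intro mult_left_mono) auto
        finally have "?B < profile n R x * (2 * c)" using False by simp
        moreover have "0 < 2 * c" by (simp add: c_def)
        ultimately have "?B / (2 * c) < profile n R x" by (simp only: pos_divide_less_eq)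
        then show False using lt by (simp add: m_def)
      qed
    qed
  qed
  then show ?thesis by (simp add: filterlim_uminus_at_top[symmetric] filterlim_uminus_at_bot)
qed

lemma concave_height_limit:
  "\<exists>l. (profile n R \<longlongrightarrow> l) (at_left (profile_sup n R))"
proof -
  have "\<exists>l. ((\<lambda>x. - profile n R x) \<longlongrightarrow> l) (at_left (profile_sup n R))"
  proof (rule mono_tendsto_at_left[OF concave_profile_sup(1), of _ 0])
    fix x y assume "0 < x" "x \<le> y" "y < profile_sup n R"
    then show "- profile n R x \<le> - profile n R y"
      using profile_decreasing[of x y] concave_profile_sup(2)[of y] by (cases "x = y") auto
  next
    fix x assume "0 < x" "x < profile_sup n R"
    then show "- profile n R x \<le> 0"
      using profile_derivs(1)[of x n R] concave_profile_sup(2)[of x] by auto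
  qed
  then show ?thesis using tendsto_minus_cancel_left by (metis minus_minus)
qed

text \<open>The estimates arise from \<open>concave_length_bound\<close> and
  \<open>concave_height_bound\<close> by letting y tend to \<open>profile_sup n R\<close>. The sign
  of \<open>r\<close> will remove the absolute value introduced by
  \<open>accumulates_on_axis\<close>.\<close>

lemma concave_tail:
  assumes r: "(profile n R \<longlongrightarrow> r) (at_left (profile_sup n R))"
    and x: "0 < x" "x \<in> profile_dom n R"
  shows "\<bar>profile_sup n R - x\<bar> \<le> R * (pi / 2 - arctan \<bar>dprofile n R x\<bar>)" and "0 \<le> r"
    and "\<lbrakk>n \<ge> 1; 0 < e; e \<le> r; 4 * (real n - 1) / (e * x) \<le> \<bar>dprofile n R x\<bar>\<rbrakk>
      \<Longrightarrow> \<bar>r - profile n R x\<bar> \<le> 4 / x * (pi / 2 - arctan \<bar>dprofile n R x\<bar>)"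
proof -
  let ?B = "profile_sup n R"
  note dom = concave_profile_sup(2)
  have xB: "x < ?B" using dom[of x] x by simp
  have ev: "\<forall>\<^sub>F y in at_left ?B. y \<in> {x<..<?B}" by (rule eventually_at_left_real[OF xB])
  have nt: "at_left ?B \<noteq> bot" by simp
  have "?B \<le> x + R * (pi / 2 - arctan \<bar>dprofile n R x\<bar>)"
  proof (rule dense_le_bounded[OF xB])
    fix y assume y: "x < y" "y < ?B"
    then show "y \<le> x + R * (pi / 2 - arctan \<bar>dprofile n R x\<bar>)"
      using concave_length_bound[OF x(1) y(1)] dom[of y] x by simp
  qed
  then show "\<bar>?B - x\<bar> \<le> R * (pi / 2 - arctan \<bar>dprofile n R x\<bar>)" using xB by simp
  have "\<forall>\<^sub>F y in at_left ?B. 0 \<le> profile n R y"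
    using ev by eventually_elim (use x dom profile_derivs(1) in \<open>auto intro!: less_imp_le\<close>)
  then show "0 \<le> r" by (rule tendsto_lowerbound[OF r _ nt])
  have le: "r \<le> profile n R y" if y: "0 < y" "y < ?B" for y
  proof (rule tendsto_upperbound[OF r _ nt])
    show "\<forall>\<^sub>F t in at_left ?B. profile n R t \<le> profile n R y"
      using eventually_at_left_real[OF y(2)]
      by eventually_elim (use profile_decreasing[of y] y dom in \<open>auto intro!: less_imp_le\<close>)
  qed
  assume n: "n \<ge> 1" and e: "0 < e" "e \<le> r" and steep: "4 * (real n - 1) / (e * x) \<le> \<bar>dprofile n R x\<bar>"
  have "profile n R x - r \<le> 4 / x * (pi / 2 - arctan \<bar>dprofile n R x\<bar>)"
  proof (rule tendsto_upperbound[OF tendsto_diff[OF tendsto_const r] _ nt])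
    show "\<forall>\<^sub>F y in at_left ?B. profile n R x - profile n R y \<le> 4 / x * (pi / 2 - arctan \<bar>dprofile n R x\<bar>)"
      using ev
    proof eventually_elim
      case (elim y)
      then show ?case using le[of y] e dom[of y] x concave_height_bound[OF x(1) _ _ n e(1) _ steep, of y] by auto
    qed
  qed
  then show "\<bar>r - profile n R x\<bar> \<le> 4 / x * (pi / 2 - arctan \<bar>dprofile n R x\<bar>)"
    using le[OF x(1) xB] by simp
qed

end

section \<open>Initial heights below the cylinder: convex branches\<close>

context
  fixes n :: nat and R :: real
  assumes R: "0 < R" "R\<^sup>2 < 2 * (real n - 1)"
begin

lemma dprofile_increasing:
  assumes "0 < x" "x < y" "y \<in> profile_dom n R"
  shows "dprofile n R x < dprofile n R y"
proof (rule DERIV_pos_imp_less[OF assms(2)])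
  fix t assume "x \<le> t" "t \<le> y"
  then have t: "0 < t" "t \<in> profile_dom n R" using profile_dom_between[OF assms(1) _ _ assms(3)] by auto
  show "(dprofile n R has_real_derivative (1 + (dprofile n R t)\<^sup>2) *
      angle_rate n t (profile n R t) (dprofile n R t)) (at t)"
    by (rule profile_derivs(3)[OF t])
next
  fix t assume "x < t" "t < y"
  then have t: "0 < t" "t \<in> profile_dom n R" using profile_dom_between[OF assms(1) _ _ assms(3), of t] by auto
  show "(1 + (dprofile n R t)\<^sup>2) * angle_rate n t (profile n R t) (dprofile n R t) > 0"
    by (intro mult_pos_pos add_pos_nonneg profile_inside_cylinder(4)[OF R t]) auto
qed

lemma profile_increasing:
  assumes "0 < x" "x < y" "y \<in> profile_dom n R"
  shows "profile n R x < profile n R y"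
  by (rule DERIV_pos_imp_less[OF assms(2), of _ "dprofile n R"])
    (use profile_dom_between[OF assms(1) _ _ assms(3)] profile_derivs(2) profile_inside_cylinder(1)[OF R] in auto)

text \<open>If the tangent line always met the axis \<open>r = 0\<close> to the left of the origin, then \<open>u / x\<close> would
  be nonincreasing, so \<open>u\<close> at most linear, and \<open>(arctan u')' \<ge> const / u\<close> would leave room only for
  a bounded domain, on which \<open>u\<close> and \<open>u'\<close> stay bounded.\<close>

lemma tangent_meets_axis_right:
  obtains x where "0 < x" "x \<in> profile_dom n R" "0 < x - profile n R x / dprofile n R x"
proof -
  have False if no: "\<And>x. 0 < x \<Longrightarrow> x \<in> profile_dom n R \<Longrightarrow> x * dprofile n R x \<le> profile n R x"
  proof -
    obtain d where d: "0 < d" "d \<in> profile_dom n R"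
      using profile_dom_open[OF order.refl zero_in_profile_dom[OF R(1)]] by blast
    define c where "c = profile n R d / d"
    have c: "c > 0" using profile_derivs(1)[OF d] d by (simp add: c_def)
    define g0 where "g0 = real n - 1 - R\<^sup>2 / 2"
    have g0: "g0 > 0" using R by (simp add: g0_def)
    \<comment> \<open>The derivative of u / x is (x * u' - u) / x^2, which \<open>no\<close> makes
      nonpositive.\<close>
    have linear: "profile n R x \<le> c * x" if x: "d < x" "x \<in> profile_dom n R" for x
    proof -
      have "- (profile n R d / d) \<le> - (profile n R x / x)"
      proof (rule DERIV_nonneg_imp_nondecreasing[where f = "\<lambda>t. - (profile n R t / t)"])
        fix t assume "d \<le> t" "t \<le> x"
        then have t: "0 < t" "t \<in> profile_dom n R" using profile_dom_between[OF d(1) _ _ x(2)] by auto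
        have "((\<lambda>t. - (profile n R t / t)) has_real_derivative
            - ((dprofile n R t * t - profile n R t * 1) / (t * t))) (at t)"
          by (intro DERIV_minus DERIV_divide profile_derivs(2)[OF t] DERIV_ident) (use t in simp)
        moreover have "- ((dprofile n R t * t - profile n R t * 1) / (t * t)) \<ge> 0"
          using no[OF t] t by (simp add: divide_le_0_iff mult.commute)
        ultimately show "\<exists>D. ((\<lambda>t. - (profile n R t / t)) has_real_derivative D) (at t) \<and> 0 \<le> D"
          by blast
      qed (use x in simp)
      then have "profile n R x / x \<le> c" by (simp add: c_def)
      then show ?thesis using d x by (simp add: divide_simps)
    qed
    \<comment> \<open>By linear growth the rate g0 / u is at least (g0 / c) / x, so arctan u' - (g0
      / c) * ln x increases; a total turning below pi then bounds ln (x / d).\<close>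
    have length: "x \<le> d * exp (pi * c / g0)" if x: "d < x" "x \<in> profile_dom n R" for x
    proof -
      have "arctan (dprofile n R d) - g0 / c * ln d < arctan (dprofile n R x) - g0 / c * ln x"
      proof (rule DERIV_pos_imp_less[OF x(1)])
        fix t assume "d \<le> t" "t \<le> x"
        then have t: "0 < t" "t \<in> profile_dom n R" using profile_dom_between[OF d(1) _ _ x(2)] by auto
        show "((\<lambda>t. arctan (dprofile n R t) - g0 / c * ln t) has_real_derivative
            angle_rate n t (profile n R t) (dprofile n R t) - g0 / c * (1 / t)) (at t)"
          by (intro DERIV_diff DERIV_cmult arctan_dprofile_deriv[OF t] DERIV_ln_divide t)
      next
        fix t assume dt: "d < t" "t < x"
        then have t: "0 < t" "t \<in> profile_dom n R" using profile_dom_between[OF d(1) _ _ x(2), of t] by auto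
        have "g0 / (c * t) \<le> g0 / profile n R t"
          using linear[OF dt(1) t(2)] profile_derivs(1)[OF t] g0 c t by (intro divide_left_mono) auto
        also have "\<dots> < angle_rate n t (profile n R t) (dprofile n R t)"
          unfolding g0_def by (rule profile_inside_cylinder(3)[OF R t])
        finally show "0 < angle_rate n t (profile n R t) (dprofile n R t) - g0 / c * (1 / t)" by simp
      qed
      then have "g0 / c * (ln x - ln d) < pi"
        using arctan_less_pi_half[of "dprofile n R d"] arctan_less_pi_half[of "dprofile n R x"]
        by (simp add: right_diff_distrib)
      then have "ln x - ln d < pi * c / g0" using g0 c by (simp add: field_simps)
      then have "ln x < ln (d * exp (pi * c / g0))" using d by (simp add: ln_mult)
      then show ?thesis using d x by (subst (asm) ln_less_cancel_iff) auto
    qed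
    define X where "X = d * exp (pi * c / g0)"
    have dX: "d \<le> X" using d c g0 by (simp add: X_def)
    obtain x where x: "0 < x" "x \<in> profile_dom n R"
      and out: "max X (max c (c * X)) < x \<or> profile n R x < R \<or>
        max X (max c (c * X)) < profile n R x \<or> max X (max c (c * X)) < \<bar>dprofile n R x\<bar>"
      using profile_leaves_bounds[OF R(1) R(1)] by blast
    have dl: "dprofile n R y \<le> c" if "d \<le> y" "y \<in> profile_dom n R" for y
    proof -
      have "y * dprofile n R y \<le> c * y"
        using no[of y] linear[of y] that d by (cases "y = d") (auto simp: c_def)
      then show ?thesis using that d by simp
    qed
    have "x \<le> X" "profile n R x \<le> c * X" "dprofile n R x \<le> c"
    proof -
      show "x \<le> X" using length[OF _ x(2)] dX unfolding X_def[symmetric] by linarith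
      show "profile n R x \<le> c * X"
      proof (cases "d < x")
        case True
        have "profile n R x \<le> c * x" by (rule linear[OF True x(2)])
        also have "\<dots> \<le> c * X" using \<open>x \<le> X\<close> c by simp
        finally show ?thesis .
      next
        case False
        then have "profile n R x \<le> profile n R d"
          using profile_increasing[OF x(1) _ d(2)] by (cases "x = d") auto
        also have "\<dots> = c * d" using d by (simp add: c_def)
        also have "\<dots> \<le> c * X" using dX c by simp
        finally show ?thesis .
      qed
      show "dprofile n R x \<le> c"
      proof (cases "d \<le> x")
        case False
        then have "dprofile n R x < dprofile n R d" using dprofile_increasing[OF x(1) _ d(2)] by simp
        then show ?thesis using dl[of d] d by simp
      qed (use dl x in blast)
    qed
    then show False using out profile_inside_cylinder(1,2)[OF R x] by auto
  qed
  then obtain x where x: "0 < x" "x \<in> profile_dom n R" "profile n R x < x * dprofile n R x"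
    by (meson linorder_not_less)
  then have "0 < x - profile n R x / dprofile n R x"
    using profile_inside_cylinder(1)[OF R x(1,2)] by (simp add: field_simps)
  then show thesis using that x by blast
qed

text \<open>The tangent meets the axis at t - u / u', whose derivative u * u'' / u'^2 is positive,
  so this point stays at or beyond \<open>k\<close>. Hence t * u' - u \<ge> k * u', and the
  remaining term (n - 1) / u of the angle rate is positive.\<close>

lemma convex_curvature_bound:
  assumes z: "0 < z" and k: "k \<le> z - profile n R z / dprofile n R z"
    and t: "z \<le> t" "t \<in> profile_dom n R"
  shows "k / 2 * dprofile n R t < angle_rate n t (profile n R t) (dprofile n R t)"
proof -
  have t0: "0 < t" "z \<in> profile_dom n R" using z t profile_dom_downward[of z t] by auto
  have v: "dprofile n R t > 0" by (rule profile_inside_cylinder(1)[OF R t0(1) t(2)])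
  have "z - profile n R z / dprofile n R z \<le> t - profile n R t / dprofile n R t"
  proof (cases "z = t")
    case False
    then have "z < t" using t by simp
    then have "z - profile n R z / dprofile n R z < t - profile n R t / dprofile n R t"
    proof (rule DERIV_pos_imp_less)
      fix s assume "z \<le> s" "s \<le> t"
      then have s: "0 < s" "s \<in> profile_dom n R" using profile_dom_between[OF z _ _ t(2)] by auto
      have "dprofile n R s \<noteq> 0" using profile_inside_cylinder(1)[OF R s] by simp
      then show "((\<lambda>s. s - profile n R s / dprofile n R s) has_real_derivative
          1 - (dprofile n R s * dprofile n R s - profile n R s * ((1 + (dprofile n R s)\<^sup>2) *
            angle_rate n s (profile n R s) (dprofile n R s))) / (dprofile n R s * dprofile n R s)) (at s)"
        by (intro DERIV_diff DERIV_ident DERIV_divide profile_derivs(2,3)[OF s])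
    next
      fix s assume "z < s" "s < t"
      then have s: "0 < s" "s \<in> profile_dom n R" using profile_dom_between[OF z _ _ t(2), of s] by auto
      note p = profile_inside_cylinder[OF R s]
      have "0 < profile n R s * ((1 + (dprofile n R s)\<^sup>2) * angle_rate n s (profile n R s) (dprofile n R s))"
        using p(2,4) R by (intro mult_pos_pos add_pos_nonneg) auto
      then have "0 < profile n R s * ((1 + (dprofile n R s)\<^sup>2) * angle_rate n s (profile n R s) (dprofile n R s))
          / (dprofile n R s * dprofile n R s)"
        using p(1) by simp
      also have "\<dots> = 1 - (dprofile n R s * dprofile n R s - profile n R s * ((1 + (dprofile n R s)\<^sup>2) *
            angle_rate n s (profile n R s) (dprofile n R s))) / (dprofile n R s * dprofile n R s)"
        using p(1) by (simp add: diff_divide_distrib)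
      finally show "0 < 1 - (dprofile n R s * dprofile n R s - profile n R s * ((1 + (dprofile n R s)\<^sup>2) *
            angle_rate n s (profile n R s) (dprofile n R s))) / (dprofile n R s * dprofile n R s)" .
    qed
    then show ?thesis by simp
  qed simp
  then have "k * dprofile n R t \<le> (t - profile n R t / dprofile n R t) * dprofile n R t"
    using k v by (intro mult_right_mono) auto
  also have "\<dots> = t * dprofile n R t - profile n R t" using v by (simp add: left_diff_distrib)
  finally have "k / 2 * dprofile n R t \<le> t / 2 * dprofile n R t - profile n R t / 2" by simp
  moreover have "2 * (real n - 1) > 0" using R zero_le_power2[of R] by linarith
  then have "(real n - 1) / profile n R t > 0" using profile_derivs(1)[OF t0(1) t(2)] by simp
  ultimately show ?thesis unfolding angle_rate_def by linarith
qed

text \<open>The tangent turns at a rate above k / 2 per unit of height, so arctan u' - k / 2 * u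
  increases. As u' increases too, the rate per unit of length exceeds k / 2 * u'(x).\<close>

lemma convex_tail_bounds:
  assumes z: "0 < z" and k: "0 < k" "k \<le> z - profile n R z / dprofile n R z"
    and xy: "z \<le> x" "x < y" "y \<in> profile_dom n R"
  shows "profile n R y - profile n R x < 2 / k * (pi / 2 - arctan \<bar>dprofile n R x\<bar>)"
    and "y - x < 2 / (k * dprofile n R x) * (pi / 2 - arctan \<bar>dprofile n R x\<bar>)"
proof -
  have x: "0 < x" "x \<in> profile_dom n R" using z xy profile_dom_downward[of x y] by auto
  have v: "0 < dprofile n R x" by (rule profile_inside_cylinder(1)[OF R x])
  have t: "0 < t \<and> t \<in> profile_dom n R" if "x \<le> t" "t \<le> y" for t
    using profile_dom_between[OF x(1) that xy(3)] .
  have "arctan (dprofile n R x) - k / 2 * profile n R x < arctan (dprofile n R y) - k / 2 * profile n R y"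
  proof (rule DERIV_pos_imp_less[OF xy(2)])
    show "((\<lambda>t. arctan (dprofile n R t) - k / 2 * profile n R t) has_real_derivative
        angle_rate n t (profile n R t) (dprofile n R t) - k / 2 * dprofile n R t) (at t)" if "x \<le> t" "t \<le> y" for t
      using t[OF that] by (intro DERIV_diff DERIV_cmult arctan_dprofile_deriv profile_derivs(2)) auto
    show "0 < angle_rate n t (profile n R t) (dprofile n R t) - k / 2 * dprofile n R t" if "x < t" "t < y" for t
      using convex_curvature_bound[OF z k(2), of t] t[of t] that xy by simp
  qed
  then have "k / 2 * (profile n R y - profile n R x) < pi / 2 - arctan \<bar>dprofile n R x\<bar>"
    using arctan_less_pi_half[of "dprofile n R y"] v by (simp add: right_diff_distrib)
  then show "profile n R y - profile n R x < 2 / k * (pi / 2 - arctan \<bar>dprofile n R x\<bar>)"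
    using k by (simp add: field_simps)
  have "arctan (dprofile n R x) - k / 2 * dprofile n R x * x < arctan (dprofile n R y) - k / 2 * dprofile n R x * y"
  proof (rule DERIV_pos_imp_less[OF xy(2)])
    show "((\<lambda>t. arctan (dprofile n R t) - k / 2 * dprofile n R x * t) has_real_derivative
        angle_rate n t (profile n R t) (dprofile n R t) - k / 2 * dprofile n R x * 1) (at t)" if "x \<le> t" "t \<le> y" for t
      using t[OF that] by (intro DERIV_diff DERIV_cmult arctan_dprofile_deriv DERIV_ident) auto
    fix t assume xt: "x < t" "t < y"
    have "k / 2 * dprofile n R x < k / 2 * dprofile n R t"
      using dprofile_increasing[OF x(1) xt(1)] t[of t] xt k by (intro mult_strict_left_mono) auto
    then show "0 < angle_rate n t (profile n R t) (dprofile n R t) - k / 2 * dprofile n R x * 1"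
      using convex_curvature_bound[OF z k(2), of t] t[of t] xt xy by simp
  qed
  then have "k * dprofile n R x / 2 * (y - x) < pi / 2 - arctan \<bar>dprofile n R x\<bar>"
    using arctan_less_pi_half[of "dprofile n R y"] v by (simp add: right_diff_distrib)
  then show "y - x < 2 / (k * dprofile n R x) * (pi / 2 - arctan \<bar>dprofile n R x\<bar>)"
    using k v by (simp add: field_simps)
qed

lemma convex_profile_sup:
  shows "0 < profile_sup n R" "0 \<le> x \<Longrightarrow> x \<in> profile_dom n R \<longleftrightarrow> x < profile_sup n R"
    and "\<exists>M. \<forall>x. 0 < x \<longrightarrow> x \<in> profile_dom n R \<longrightarrow> profile n R x \<le> M"
proof -
  obtain z where z: "0 < z" "z \<in> profile_dom n R" and k: "0 < z - profile n R z / dprofile n R z"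
    using tangent_meets_axis_right .
  let ?k = "z - profile n R z / dprofile n R z" and ?d = "pi / 2 - arctan \<bar>dprofile n R z\<bar>"
  have d: "?d > 0" using arctan_less_pi_half[of "\<bar>dprofile n R z\<bar>"] by simp
  have v: "0 < dprofile n R z" by (rule profile_inside_cylinder(1)[OF R z])
  have C: "x \<le> z + 2 / (?k * dprofile n R z) * ?d" if x: "0 < x" "x \<in> profile_dom n R" for x
  proof (cases "z < x")
    case True
    then show ?thesis using convex_tail_bounds(2)[OF z(1) k order.refl order.refl True x(2)] by simp
  next
    case False
    moreover have "0 < 2 / (?k * dprofile n R z) * ?d"
      by (intro mult_pos_pos divide_pos_pos k v d) simp
    ultimately show ?thesis by linarith
  qed
  show "0 < profile_sup n R" "0 \<le> x \<Longrightarrow> x \<in> profile_dom n R \<longleftrightarrow> x < profile_sup n R"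
    by (rule profile_sup[OF R(1) C]; assumption)+
  have "profile n R x \<le> profile n R z + 2 / ?k * ?d" if x: "0 < x" "x \<in> profile_dom n R" for x
  proof (cases "z < x")
    case True
    then show ?thesis using convex_tail_bounds(1)[OF z(1) k order.refl order.refl True x(2)] by simp
  next
    case False
    then have "profile n R x \<le> profile n R z"
      using profile_increasing[OF x(1) _ z(2)] by (cases "x = z") auto
    moreover have "0 < 2 / ?k * ?d" by (intro mult_pos_pos divide_pos_pos k d) simp
    ultimately show ?thesis by linarith
  qed
  then show "\<exists>M. \<forall>x. 0 < x \<longrightarrow> x \<in> profile_dom n R \<longrightarrow> profile n R x \<le> M" by blast
qed

text \<open>The domain is bounded and the heights lie between \<open>R\<close> and \<open>M\<close>,
  so the slope is the only coordinate through which the curve can leave every box.\<close>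

lemma convex_vertical:
  "filterlim (dprofile n R) at_top (at_left (profile_sup n R))"
proof (rule mono_unbounded_at_left)
  let ?B = "profile_sup n R"
  note B = convex_profile_sup(1,2)
  fix x y assume "0 < x" "x \<le> y" "y < ?B"
  then show "dprofile n R x \<le> dprofile n R y"
    using dprofile_increasing[of x y] B(2)[of y] by (cases "x = y") auto
next
  let ?B = "profile_sup n R"
  note B = convex_profile_sup(1,2)
  fix Z
  obtain M where M: "\<And>x. 0 < x \<Longrightarrow> x \<in> profile_dom n R \<Longrightarrow> profile n R x \<le> M"
    using convex_profile_sup(3) by blast
  obtain x where x: "0 < x" "x \<in> profile_dom n R"
    and out: "max (max ?B M) Z < x \<or> profile n R x < R
      \<or> max (max ?B M) Z < profile n R x \<or> max (max ?B M) Z < \<bar>dprofile n R x\<bar>"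
    using profile_leaves_bounds[OF R(1) R(1)] by blast
  have "x < ?B" using B(2)[of x] x by simp
  moreover have "Z \<le> dprofile n R x"
    using out M[OF x] \<open>x < ?B\<close> profile_inside_cylinder(1,2)[OF R x] by auto
  ultimately show "\<exists>x. 0 < x \<and> x < ?B \<and> Z \<le> dprofile n R x" using x by blast
qed

lemma convex_height_limit:
  "\<exists>l. (profile n R \<longlongrightarrow> l) (at_left (profile_sup n R))"
proof -
  obtain M where M: "\<And>x. 0 < x \<Longrightarrow> x \<in> profile_dom n R \<Longrightarrow> profile n R x \<le> M"
    using convex_profile_sup(3) by blast
  show ?thesis
  proof (rule mono_tendsto_at_left[OF convex_profile_sup(1), of _ M])
    fix x y assume "0 < x" "x \<le> y" "y < profile_sup n R"
    then show "profile n R x \<le> profile n R y"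
      using profile_increasing[of x y] convex_profile_sup(2)[of y] by (cases "x = y") auto
  next
    fix x assume "0 < x" "x < profile_sup n R"
    then show "profile n R x \<le> M" using M[of x] convex_profile_sup(2)[of x] by auto
  qed
qed

lemma convex_tail:
  assumes r: "(profile n R \<longlongrightarrow> r) (at_left (profile_sup n R))"
    and z: "0 < z" and k: "0 < k" "k \<le> z - profile n R z / dprofile n R z"
    and x: "z < x" "x \<in> profile_dom n R" and steep: "1 < \<bar>dprofile n R x\<bar>"
  shows "\<bar>profile_sup n R - x\<bar> \<le> 2 / k * (pi / 2 - arctan \<bar>dprofile n R x\<bar>)"
    and "\<bar>r - profile n R x\<bar> \<le> 2 / k * (pi / 2 - arctan \<bar>dprofile n R x\<bar>)"
proof -
  let ?B = "profile_sup n R" and ?d = "pi / 2 - arctan \<bar>dprofile n R x\<bar>"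
  note dom = convex_profile_sup(2)
  have x0: "0 < x" using z x by simp
  have v: "1 < dprofile n R x" using steep profile_inside_cylinder(1)[OF R x0 x(2)] by simp
  have d: "?d > 0" using arctan_less_pi_half[of "\<bar>dprofile n R x\<bar>"] by simp
  have xB: "x < ?B" using dom[of x] x0 x by simp
  have ev: "\<forall>\<^sub>F y in at_left ?B. y \<in> {x<..<?B}" by (rule eventually_at_left_real[OF xB])
  have nt: "at_left ?B \<noteq> bot" by simp
  have "?B \<le> x + 2 / k * ?d"
  proof (rule dense_le_bounded[OF xB])
    fix y assume y: "x < y" "y < ?B"
    \<comment> \<open>A slope above 1 may be dropped from the denominator, so that the constant 2 /
      k serves both length and height.\<close>
    have "2 / (k * dprofile n R x) * ?d \<le> 2 / k * ?d"
      using v k d by (intro mult_right_mono divide_left_mono) auto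
    then show "y \<le> x + 2 / k * ?d"
      using convex_tail_bounds(2)[OF z k less_imp_le[OF x(1)] y(1)] dom[of y] y x0 by simp
  qed
  then show "\<bar>?B - x\<bar> \<le> 2 / k * ?d" using xB by simp
  have "profile n R x \<le> r"
    by (rule tendsto_lowerbound[OF r eventually_mono[OF ev] nt])
      (use profile_increasing[OF x0] dom x0 in \<open>auto intro!: less_imp_le\<close>)
  moreover have "r - profile n R x \<le> 2 / k * ?d"
    by (rule tendsto_upperbound[OF tendsto_diff[OF r tendsto_const] eventually_mono[OF ev] nt])
      (use convex_tail_bounds(1)[OF z k less_imp_le[OF x(1)]] dom x0 in \<open>auto intro!: less_imp_le\<close>)
  ultimately show "\<bar>r - profile n R x\<bar> \<le> 2 / k * ?d" by simp
qed

end

section \<open>Vertical points as functions of the initial height, and the theorem\<close>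

definition vertical_height :: "nat \<Rightarrow> real \<Rightarrow> real" where
  "vertical_height n R = Lim (at_left (profile_sup n R)) (profile n R)"

lemma vertical_height:
  assumes "\<exists>l. (profile n R \<longlongrightarrow> l) (at_left (profile_sup n R))"
  shows "(profile n R \<longlongrightarrow> vertical_height n R) (at_left (profile_sup n R))"
  using assms unfolding vertical_height_def
  by (metis tendsto_Lim trivial_limit_at_left_real)

lemma deriv_dprofile_eq:
  assumes "0 < x" "x \<in> profile_dom n R"
  shows "deriv (dprofile n R) x = (1 + (dprofile n R x)\<^sup>2) * angle_rate n x (profile n R x) (dprofile n R x)"
  by (rule DERIV_imp_deriv[OF profile_derivs(3)[OF assms]])

lemma concave_branch:
  assumes R: "R > sqrt (2 * real n)"
  shows "vertical_at at_bot n R (profile_sup n R)"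
    "(profile n R \<longlongrightarrow> vertical_height n R) (at_left (profile_sup n R))"
    "\<forall>x\<in>{0<..<profile_sup n R}. deriv (dprofile n R) x < 0"
proof -
  note B = concave_profile_sup[OF R]
  show "vertical_at at_bot n R (profile_sup n R)"
    using B concave_vertical[OF R] by (auto simp: vertical_at_def)
  show "(profile n R \<longlongrightarrow> vertical_height n R) (at_left (profile_sup n R))"
    by (rule vertical_height[OF concave_height_limit[OF R]])
  show "\<forall>x\<in>{0<..<profile_sup n R}. deriv (dprofile n R) x < 0"
  proof
    fix x assume "x \<in> {0<..<profile_sup n R}"
    then have x: "0 < x" "x \<in> profile_dom n R" using B(2)[of x] by auto
    have "angle_rate n x (profile n R x) (dprofile n R x) < - 1 / R" by (rule profile_outside_sphere(6)[OF R x])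
    also have "\<dots> < 0" using sphere_radius_pos[OF R] by simp
    finally show "deriv (dprofile n R) x < 0"
      unfolding deriv_dprofile_eq[OF x] by (intro mult_pos_neg add_pos_nonneg) auto
  qed
qed

lemma convex_branch:
  assumes R: "0 < R" "R\<^sup>2 < 2 * (real n - 1)"
  shows "vertical_at at_top n R (profile_sup n R)"
    "(profile n R \<longlongrightarrow> vertical_height n R) (at_left (profile_sup n R))"
    "\<forall>x\<in>{0<..<profile_sup n R}. deriv (dprofile n R) x > 0"
proof -
  note B = convex_profile_sup(1,2)[OF R]
  show "vertical_at at_top n R (profile_sup n R)"
    using B convex_vertical[OF R] by (auto simp: vertical_at_def)
  show "(profile n R \<longlongrightarrow> vertical_height n R) (at_left (profile_sup n R))"
    by (rule vertical_height[OF convex_height_limit[OF R]])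
  show "\<forall>x\<in>{0<..<profile_sup n R}. deriv (dprofile n R) x > 0"
  proof
    fix x assume "x \<in> {0<..<profile_sup n R}"
    then have x: "0 < x" "x \<in> profile_dom n R" using B(2)[of x] by auto
    show "deriv (dprofile n R) x > 0"
      unfolding deriv_dprofile_eq[OF x]
      by (intro mult_pos_pos add_pos_nonneg profile_inside_cylinder(4)[OF R x]) auto
  qed
qed

text \<open>The point is uniformity in \<open>S\<close>: the constants of the tail estimates depend
  on \<open>S\<close> and x and must be replaced by common ones. Excluding accumulation on the axis
  yields one lower bound \<open>e\<close> for all nearby vertical heights.\<close>

lemma concave_vertical_point_isCont:
  assumes n: "n \<ge> 1" and R: "R > sqrt (2 * real n)"
    and axis: "\<not> accumulates_on_axis (\<lambda>S. (profile_sup n S, vertical_height n S)) R"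
  shows "isCont (\<lambda>S. (profile_sup n S, vertical_height n S)) R"
proof -
  note B = concave_profile_sup[OF R]
  let ?z = "profile_sup n R / 2"
  obtain e where e: "e > 0" and ev: "\<forall>\<^sub>F S in at R. e \<le> \<bar>vertical_height n S\<bar>"
    using axis by (auto simp: accumulates_on_axis_def not_frequently not_less)
  define c where "c = 4 * (real n - 1) / (e * ?z)"
  \<comment> \<open>\<open>R + 1\<close> dominates every nearby \<open>S\<close> in the length
    estimate, and 4 / z dominates 4 / x in the height estimate, since only points x beyond half of
    the domain of \<open>R\<close> are used.\<close>
  define C where "C = max (R + 1) (4 / ?z)"
  show ?thesis
  proof (rule isCont_vertical_point[where z = ?z and c = c and C = C])
    show "filterlim (\<lambda>x. \<bar>dprofile n R x\<bar>) at_top (at_left (profile_sup n R))"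
    proof (rule filterlim_at_top_mono)
      show "filterlim (\<lambda>x. - dprofile n R x) at_top (at_left (profile_sup n R))"
        using concave_vertical[OF R] by (simp add: filterlim_uminus_at_bot)
    qed (auto intro!: always_eventually)
    have "\<forall>\<^sub>F S in at R. S \<in> {sqrt (2 * real n)<..<R + 1}"
      by (rule eventually_at_in_open') (use R in auto)
    then show "\<forall>\<^sub>F S in at R. \<forall>x. 0 < x \<longrightarrow> x \<in> profile_dom n S \<longrightarrow> ?z < x \<longrightarrow> c < \<bar>dprofile n S x\<bar> \<longrightarrow>
      \<bar>profile_sup n S - x\<bar> \<le> C * (pi / 2 - arctan \<bar>dprofile n S x\<bar>) \<and>
      \<bar>vertical_height n S - profile n S x\<bar> \<le> C * (pi / 2 - arctan \<bar>dprofile n S x\<bar>)"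
      using ev
    proof (eventually_elim, intro allI impI)
      fix S x
      assume S: "S \<in> {sqrt (2 * real n)<..<R + 1}" and eS: "e \<le> \<bar>vertical_height n S\<bar>"
        and x: "0 < x" "x \<in> profile_dom n S" "?z < x" and steep: "c < \<bar>dprofile n S x\<bar>"
      have S1: "S > sqrt (2 * real n)" using S by simp
      let ?d = "pi / 2 - arctan \<bar>dprofile n S x\<bar>"
      have d: "?d \<ge> 0" using arctan_less_pi_half[of "\<bar>dprofile n S x\<bar>"] by simp
      note tail = concave_tail[OF S1 concave_branch(2)[OF S1] x(1,2)]
      have "S * ?d \<le> C * ?d" using S d by (intro mult_right_mono) (auto simp: C_def)
      then have 1: "\<bar>profile_sup n S - x\<bar> \<le> C * ?d" using tail(1) by simp
      have "e * ?z \<le> e * x" using e x by simp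
      then have "4 * (real n - 1) / (e * x) \<le> c"
        unfolding c_def using e x n B(1) by (intro divide_left_mono) auto
      then have "\<bar>vertical_height n S - profile n S x\<bar> \<le> 4 / x * ?d"
        using tail(2) eS steep n e by (intro tail(3)[of e]) auto
      also have "\<dots> \<le> C * ?d"
      proof (rule mult_right_mono[OF _ d])
        have "4 / x \<le> 4 / ?z" using x B(1) by (intro divide_left_mono) auto
        then show "4 / x \<le> C" by (simp add: C_def)
      qed
      finally show "\<bar>profile_sup n S - x\<bar> \<le> C * ?d \<and> \<bar>vertical_height n S - profile n S x\<bar> \<le> C * ?d"
        using 1 by simp
    qed
  qed (use B concave_branch(2)[OF R] in auto)
qed

lemma convex_vertical_point_isCont:
  assumes R: "0 < R" "R\<^sup>2 < 2 * (real n - 1)"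
  shows "isCont (\<lambda>S. (profile_sup n S, vertical_height n S)) R"
proof -
  note B = convex_profile_sup(1,2)[OF R]
  obtain z where z: "0 < z" "z \<in> profile_dom n R" and k: "0 < z - profile n R z / dprofile n R z"
    using tangent_meets_axis_right[OF R] .
  \<comment> \<open>The intercept of the tangent at the fixed point \<open>z\<close> depends
    continuously on \<open>S\<close>; half its value at \<open>R\<close> is therefore a lower bound
    for all \<open>S\<close> near \<open>R\<close>, which makes 2 / k' a uniform constant.\<close>
  define k' where "k' = (z - profile n R z / dprofile n R z) / 2"
  have k': "0 < k'" "k' < z - profile n R z / dprofile n R z" using k by (auto simp: k'_def)
  show ?thesis
  proof (rule isCont_vertical_point[where z = z and c = 1 and C = "2 / k'"])
    show "filterlim (\<lambda>x. \<bar>dprofile n R x\<bar>) at_top (at_left (profile_sup n R))"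
      by (rule filterlim_at_top_mono[OF convex_vertical[OF R]]) (auto intro!: always_eventually)
    have "((\<lambda>S. z - profile n S z / dprofile n S z) \<longlongrightarrow> z - profile n R z / dprofile n R z) (at R)"
      using profile_inside_cylinder(1)[OF R z]
      by (intro tendsto_intros profile_stable(2,3)[OF z]) auto
    then have "\<forall>\<^sub>F S in at R. k' < z - profile n S z / dprofile n S z"
      using k'(2) by (rule order_tendstoD(1))
    moreover have "((\<lambda>S. S\<^sup>2) \<longlongrightarrow> R\<^sup>2) (at R)" by (intro tendsto_intros)
    then have "\<forall>\<^sub>F S in at R. S\<^sup>2 < 2 * (real n - 1)" using R(2) by (rule order_tendstoD(2))
    moreover have "\<forall>\<^sub>F S in at R. 0 < S"
      using R(1) by (intro order_tendstoD(1)[OF tendsto_ident_at])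
    ultimately show "\<forall>\<^sub>F S in at R. \<forall>x. 0 < x \<longrightarrow> x \<in> profile_dom n S \<longrightarrow> z < x \<longrightarrow> 1 < \<bar>dprofile n S x\<bar> \<longrightarrow>
      \<bar>profile_sup n S - x\<bar> \<le> 2 / k' * (pi / 2 - arctan \<bar>dprofile n S x\<bar>) \<and>
      \<bar>vertical_height n S - profile n S x\<bar> \<le> 2 / k' * (pi / 2 - arctan \<bar>dprofile n S x\<bar>)"
    proof eventually_elim
      case (elim S)
      note S = elim(3,2)
      show ?case
        using convex_tail[OF S convex_branch(2)[OF S] z(1) k'(1) less_imp_le[OF elim(1)]] by blast
    qed
  qed (use B convex_branch(2)[OF R] z in auto)
qed

theorem lemma3:
  fixes n :: nat
  assumes "n \<ge> 2"
  shows
    "(\<forall>R1 R2 :: real.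
        R1 > R2 \<and> R2 > sqrt (2 * real n) \<and>
        (\<exists>b1. vertical_at at_bot n R1 b1) \<and> (\<exists>b2. vertical_at at_bot n R2 b2) \<longrightarrow>
        (\<exists>b r :: real \<Rightarrow> real.
           (\<forall>R\<in>{R2<..<R1}.
              vertical_at at_bot n R (b R) \<and>
              (profile n R \<longlongrightarrow> r R) (at_left (b R)) \<and>
              (\<forall>x\<in>{0<..<b R}. deriv (deriv (profile n R)) x < 0)) \<and>
           (\<forall>R\<in>{R2<..<R1}.
              \<not> accumulates_on_axis (\<lambda>S. (b S, r S)) R \<and>
              \<not> escapes_to_infinity (\<lambda>S. (b S, r S)) R \<longrightarrow>
              isCont (\<lambda>S. (b S, r S)) R)))
     \<and>
     (\<forall>R1 R2 :: real.
        0 < R2 \<and> R2 < R1 \<and> R1 < sqrt (2 * (real n - 1)) \<and>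
        (\<exists>b1. vertical_at at_top n R1 b1) \<and> (\<exists>b2. vertical_at at_top n R2 b2) \<longrightarrow>
        (\<exists>b r :: real \<Rightarrow> real.
           (\<forall>R\<in>{R2<..<R1}.
              vertical_at at_top n R (b R) \<and>
              (profile n R \<longlongrightarrow> r R) (at_left (b R)) \<and>
              (\<forall>x\<in>{0<..<b R}. deriv (deriv (profile n R)) x > 0)) \<and>
           (\<forall>R\<in>{R2<..<R1}.
              \<not> escapes_to_infinity (\<lambda>S. (b S, r S)) R \<longrightarrow>
              isCont (\<lambda>S. (b S, r S)) R)))"
proof (intro conjI allI impI; elim conjE)
  fix R1 R2 :: real assume R2: "R2 > sqrt (2 * real n)"
  have "R > sqrt (2 * real n)" if "R \<in> {R2<..<R1}" for R using that R2 by simp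
  note * = concave_branch[OF this] concave_vertical_point_isCont[OF _ this]
  show "\<exists>b r :: real \<Rightarrow> real.
           (\<forall>R\<in>{R2<..<R1}.
              vertical_at at_bot n R (b R) \<and>
              (profile n R \<longlongrightarrow> r R) (at_left (b R)) \<and>
              (\<forall>x\<in>{0<..<b R}. deriv (deriv (profile n R)) x < 0)) \<and>
           (\<forall>R\<in>{R2<..<R1}.
              \<not> accumulates_on_axis (\<lambda>S. (b S, r S)) R \<and>
              \<not> escapes_to_infinity (\<lambda>S. (b S, r S)) R \<longrightarrow>
              isCont (\<lambda>S. (b S, r S)) R)"
    using assms by (intro exI[of _ "profile_sup n"] exI[of _ "vertical_height n"] conjI ballI impI *) auto
next
  fix R1 R2 :: real assume R12: "0 < R2" "R1 < sqrt (2 * (real n - 1))"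
  have "0 < R" "R\<^sup>2 < 2 * (real n - 1)" if "R \<in> {R2<..<R1}" for R
    using that R12 power_strict_mono[of R "sqrt (2 * (real n - 1))" 2] assms by auto
  note * = convex_branch[OF this] convex_vertical_point_isCont[OF this]
  show "\<exists>b r :: real \<Rightarrow> real.
           (\<forall>R\<in>{R2<..<R1}.
              vertical_at at_top n R (b R) \<and>
              (profile n R \<longlongrightarrow> r R) (at_left (b R)) \<and>
              (\<forall>x\<in>{0<..<b R}. deriv (deriv (profile n R)) x > 0)) \<and>
           (\<forall>R\<in>{R2<..<R1}.
              \<not> escapes_to_infinity (\<lambda>S. (b S, r S)) R \<longrightarrow>
              isCont (\<lambda>S. (b S, r S)) R)"
    by (intro exI[of _ "profile_sup n"] exI[of _ "vertical_height n"] conjI ballI impI *) auto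
qed

end
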